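(* Let $d\ge 1$, $m\ge 0$ be integers, let $\boldsymbol r=(r_0,\dots,r_d)$ be integers with $r_d=0$, $r_{d-1}=m$, $r_\ell\ge 2r_{\ell+1}$ for $\ell=d-2,\dots,0$, and let $k\ge 2r_0+1$. Let $T\subset\mathbb R^d$ be a nondegenerate $d$-simplex. For $\alpha\in\mathbb T_k^d$, let $f$ be the unique sub-simplex of $T$, of dimension $\ell$ say, with $\alpha\in S_\ell(f)$, and define the functional on $\mathbb P_k(T)$ $$\mathtt L_f^{\alpha}(u):=\Big\langle \mathtt b^{\alpha_f},\ \frac{\partial^{|\alpha_{f^*}|}u}{\partial n_f^{\alpha_{f^*}}}\Big|_f\Big\rangle ,$$ where $n_f$ is the rescaled tangential-normal basis of the normal plane of $f$. Then the matrix $(D_{\alpha,\beta})_{\alpha,\beta\in\mathbb T_k^d}$ with entries $$D_{\alpha,\beta}:=\mathtt L_f^{\alpha}(B^\beta)=\Big\langle \mathtt b^{\alpha_f},\frac{\partial^{|\alpha_{f^*}|}B^\beta}{\partial n_f^{\alpha_{f^*}}}\Big|_f\Big\rangle=\big\langle \mathtt b^{\alpha_f},\ (\nabla^{|\alpha_{f^*}|}B^\beta)|_f: n_f^{\otimes\alpha_{f^*}}\big\rangle$$ is block lower triangular and invertible, where the blocks are indexed by the sets $S_\ell(f)\cap L(f,s)$, ordered first by increasing dimension $\ell$, then by $f$ (in any fixed order of the $\ell$-dimensional sub-simplices), then by increasing $s=0,\dots,r_\ell$. Furthermore, for every $\ell=0,\dots,d$, every $\ell$-dimensional sub-simplex $f$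 of $T$ and every $s=0,1,\dots,r_\ell$, $$D_{\alpha,\beta}=\frac{k!}{(k-s)!}\,\delta_{\alpha,\beta}\qquad\text{for all }\alpha,\beta\in S_\ell(f)\cap L(f,s).$$
   Context: Notation. $T$ has vertices $\mathtt v_0,\dots,\mathtt v_d$ and barycentric coordinates $\lambda=(\lambda_0,\dots,\lambda_d)$. $\mathbb P_k(T)$ is the space of polynomials of degree $\le k$. $\mathbb T_k^d=\{\alpha\in\mathbb N^{d+1}:|\alpha|=\alpha_0+\dots+\alpha_d=k\}$ (with $0\in\mathbb N$). The Bernstein basis is $B^\beta=\frac{k!}{\beta!}\lambda^\beta$, $\beta\in\mathbb T_k^d$. Sub-simplices. An $\ell$-dimensional sub-simplex is a subset $f\subseteq\{0,\dots,d\}$ with $\ell+1$ elements, listed as $f(0)<\dots<f(\ell)$; it is identified with the convex hull of $\{\mathtt v_i:i\in f\}$. $\Delta_\ell(T)$ is the set of these, $\Delta_i(f)$ the set of $i$-dimensional sub-simplices contained in $f$; $f^*=\{0,\dots,d\}\setminus f$. For $\alpha\in\mathbb T_k^d$, $\alpha_f=(\alpha_{f(0)},\dots,\alpha_{f(\ell)})$, and $\alpha_{f^*}$ is defined likewise. The lattice distance is $\operatorname{dist}(\alpha,f)=|\alpha_{f^*}|=\sum_{i\in f^*}\alpha_i$ (equal to $0$ for $f=T$). Lattice sets. $L(f,s)=\{\alpha\in\mathbb T_k^d:\operatorname{dist}(\alpha,f)=s\}$, $D(f,r)=\{\alpha\in\mathbb T_k^d:\operatorname{dist}(\alpha,f)\le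 r\}$, and for $f\in\Delta_\ell(T)$ $$S_\ell(f)=D(f,r_\ell)\setminus\bigcup_{i=0}^{\ell-1}\bigcup_{e\in\Delta_i(f)}D(e,r_i).$$ Under the stated hypotheses on $\boldsymbol r$ and $k$, it is known that $\mathbb T_k^d$ is the disjoint union of all $S_\ell(f)$, $f\in\Delta_\ell(T)$, $0\le\ell\le d$. Dual functionals. For $f\in\Delta_\ell(T)$ and a degree $j$, the Bernstein basis of $\mathbb P_j(f)$ is $B_f^{\mu}=\frac{j!}{\mu!}\prod_{i=0}^\ell\lambda_{f(i)}^{\mu_i}$, $\mu\in\mathbb T_j^\ell$; $\{\mathtt b^{\mu}\}_{\mu\in\mathbb T_j^\ell}\subset\mathbb P_j(f)'$ is its dual basis, $\langle\mathtt b^\mu,B_f^\nu\rangle=\delta_{\mu,\nu}$. In $\mathtt L_f^\alpha$, $\mathtt b^{\alpha_f}$ acts on $\mathbb P_{|\alpha_f|}(f)$, $|\alpha_f|=k-|\alpha_{f^*}|$. Normal basis and derivatives. For $f\in\Delta_\ell(T)$, $\ell\le d-1$, and $i\in f^*$, $\nabla_{f\cup\{i\}}\lambda_i$ is the orthogonal projection of $\nabla\lambda_i$ onto the tangent space of the $(\ell+1)$-dimensional sub-simplex $f\cup\{i\}$. The rescaled tangential-normal basis is $n_f=\{\nabla_{f\cup\{i\}}\lambda_i/|\nabla_{f\cup\{i\}}\lambda_i|^2 : i\in f^*\}$, ordered as $f^*$. For vectors $n=(\boldsymbol n_1,\dots,\boldsymbol n_p)$ and a multi-index $\gamma\in\mathbb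 N^p$ with $|\gamma|=s$, $n^{\otimes\gamma}=\boldsymbol n_1^{\otimes\gamma_1}\otimes\cdots\otimes\boldsymbol n_p^{\otimes\gamma_p}$ and $\frac{\partial^s u}{\partial n^\gamma}=\nabla^s u:n^{\otimes\gamma}$, with $:$ the Euclidean inner product on $(\mathbb R^d)^{\otimes s}$. For $f=T$ ($\ell=d$) the multi-index $\alpha_{f^*}$ is empty and no derivative is taken. *)

theory Defs
  imports "HOL-Analysis.Analysis"
begin

text \<open>
  The ambient space is \<open>real^'n\<close>, with \<open>d = CARD('n)\<close>.  The vertices of the simplex are
  \<open>v 0, \<dots>, v d\<close> for some \<open>v :: nat \<Rightarrow> real^'n\<close>; a sub-simplex is a set \<open>f\<close> of vertex indices.
  A multi-index is a function on \<open>nat\<close> that vanishes outside its index range.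
\<close>

section \<open>Simplicial lattice and sub-simplices\<close>

definition lattice :: "nat \<Rightarrow> nat \<Rightarrow> (nat \<Rightarrow> nat) set" where
  "lattice l j = {\<alpha>. (\<forall>i>l. \<alpha> i = 0) \<and> (\<Sum>i\<le>l. \<alpha> i) = j}"

definition Delta :: "nat \<Rightarrow> nat set \<Rightarrow> nat set set" where
  "Delta l f = {e. e \<subseteq> f \<and> card e = l + 1}"

definition opposite :: "nat \<Rightarrow> nat set \<Rightarrow> nat set" where
  "opposite d f = {0..d} - f"

text \<open>The restricted multi-index \<open>(\<alpha>\<^bsub>f(0)\<^esub>, \<alpha>\<^bsub>f(1)\<^esub>, \<dots>)\<close> with \<open>f(0) < f(1) < \<dots>\<close>.\<close>

definition restr_index :: "(nat \<Rightarrow> nat) \<Rightarrow> nat set \<Rightarrow> nat \<Rightarrow> nat" where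
  "restr_index \<alpha> f = (\<lambda>i. if i < card f then \<alpha> (sorted_list_of_set f ! i) else 0)"

definition ldist :: "nat \<Rightarrow> (nat \<Rightarrow> nat) \<Rightarrow> nat set \<Rightarrow> nat" where
  "ldist d \<alpha> f = (\<Sum>i\<in>opposite d f. \<alpha> i)"

definition Lset :: "nat \<Rightarrow> nat \<Rightarrow> nat set \<Rightarrow> nat \<Rightarrow> (nat \<Rightarrow> nat) set" where
  "Lset d k f s = {\<alpha> \<in> lattice d k. ldist d \<alpha> f = s}"

definition Dset :: "nat \<Rightarrow> nat \<Rightarrow> nat set \<Rightarrow> nat \<Rightarrow> (nat \<Rightarrow> nat) set" where
  "Dset d k f \<rho> = {\<alpha> \<in> lattice d k. ldist d \<alpha> f \<le> \<rho>}"

definition Sset :: "nat \<Rightarrow> nat \<Rightarrow> (nat \<Rightarrow> nat) \<Rightarrow> nat \<Rightarrow> nat set \<Rightarrow> (nat \<Rightarrow> nat) set" where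
  "Sset d k r l f = Dset d k f (r l) - (\<Union>i<l. \<Union>e\<in>Delta i f. Dset d k e (r i))"

definition simplex_of :: "nat \<Rightarrow> nat \<Rightarrow> (nat \<Rightarrow> nat) \<Rightarrow> (nat \<Rightarrow> nat) \<Rightarrow> nat set" where
  "simplex_of d k r \<alpha> = (THE f. \<exists>l\<le>d. f \<in> Delta l {0..d} \<and> \<alpha> \<in> Sset d k r l f)"

section \<open>Barycentric coordinates, polynomials and Bernstein bases\<close>

definition bary :: "(nat \<Rightarrow> real^'n) \<Rightarrow> nat \<Rightarrow> real^'n \<Rightarrow> real" where
  "bary v i x = (THE c. (\<forall>j>CARD('n). c j = 0) \<and> (\<Sum>j\<le>CARD('n). c j) = 1
                        \<and> (\<Sum>j\<le>CARD('n). c j *\<^sub>R v j) = x) i"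

definition subsimplex :: "(nat \<Rightarrow> real^'n) \<Rightarrow> nat set \<Rightarrow> (real^'n) set" where
  "subsimplex v f = convex hull (v ` f)"

definition polys :: "nat \<Rightarrow> (real^'n \<Rightarrow> real) set" where
  "polys j = {p. \<exists>c. p = (\<lambda>x. \<Sum>a | (\<Sum>i\<in>UNIV. a i) \<le> j. c a * (\<Prod>i\<in>UNIV. (x $ i) ^ a i))}"

text \<open>Functions on a set \<open>S\<close> are represented by functions on the whole space vanishing off \<open>S\<close>, so
  that pointwise sums and multiples of such functions are again of this form.\<close>

definition restr :: "(real^'n) set \<Rightarrow> (real^'n \<Rightarrow> real) \<Rightarrow> real^'n \<Rightarrow> real" where
  "restr S u = (\<lambda>x. if x \<in> S then u x else 0)"

definition polys_on :: "(nat \<Rightarrow> real^'n) \<Rightarrow> nat set \<Rightarrow> nat \<Rightarrow> (real^'n \<Rightarrow> real) set" where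
  "polys_on v f j = restr (subsimplex v f) ` polys j"

definition bernstein :: "(nat \<Rightarrow> real^'n) \<Rightarrow> nat \<Rightarrow> (nat \<Rightarrow> nat) \<Rightarrow> real^'n \<Rightarrow> real" where
  "bernstein v k \<beta> = (\<lambda>x. fact k / (\<Prod>i\<le>CARD('n). fact (\<beta> i)) * (\<Prod>i\<le>CARD('n). bary v i x ^ \<beta> i))"

definition bernstein_on ::
    "(nat \<Rightarrow> real^'n) \<Rightarrow> nat set \<Rightarrow> nat \<Rightarrow> (nat \<Rightarrow> nat) \<Rightarrow> real^'n \<Rightarrow> real" where
  "bernstein_on v f j \<mu> = restr (subsimplex v f)
     (\<lambda>x. fact j / (\<Prod>i<card f. fact (\<mu> i))
          * (\<Prod>i<card f. bary v (sorted_list_of_set f ! i) x ^ \<mu> i))"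

text \<open>Elements of the dual space of a function space \<open>P\<close>; off \<open>P\<close> they are normalised to \<open>0\<close>,
  which makes them determined by their values on \<open>P\<close>.\<close>

definition dual_space :: "('a \<Rightarrow> real) set \<Rightarrow> (('a \<Rightarrow> real) \<Rightarrow> real) set" where
  "dual_space P = {b. (\<forall>p\<in>P. \<forall>q\<in>P. b (\<lambda>x. p x + q x) = b p + b q)
                    \<and> (\<forall>c. \<forall>p\<in>P. b (\<lambda>x. c * p x) = c * b p)
                    \<and> (\<forall>p. p \<notin> P \<longrightarrow> b p = 0)}"

definition bernstein_dual ::
    "(nat \<Rightarrow> real^'n) \<Rightarrow> nat set \<Rightarrow> nat \<Rightarrow> (nat \<Rightarrow> nat) \<Rightarrow> (real^'n \<Rightarrow> real) \<Rightarrow> real" where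
  "bernstein_dual v f j \<mu> = (THE b. b \<in> dual_space (polys_on v f j)
     \<and> (\<forall>\<nu>\<in>lattice (card f - 1) j. b (bernstein_on v f j \<nu>) = (if \<mu> = \<nu> then 1 else 0)))"

section \<open>Derivative tensors and the tangential-normal basis\<close>

definition gradient :: "(real^'n \<Rightarrow> real) \<Rightarrow> real^'n \<Rightarrow> real^'n" where
  "gradient u x = (THE D. GDERIV u x :> D)"

text \<open>A tensor of order \<open>s\<close> is given by its components, indexed by the lists of length \<open>s\<close>.
  \<open>nabla u x\<close> collects the derivative tensors of all orders: its components with index lists of
  length \<open>s\<close> form the tensor of all partial derivatives of order \<open>s\<close> of \<open>u\<close> at \<open>x\<close>.\<close>

type_synonym 'n tensor = "'n list \<Rightarrow> real"

fun partial :: "(real^'n \<Rightarrow> real) \<Rightarrow> 'n list \<Rightarrow> real^'n \<Rightarrow> real" where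
  "partial u [] = u"
| "partial u (i # I) = (\<lambda>x. gradient (partial u I) x $ i)"

definition nabla :: "(real^'n \<Rightarrow> real) \<Rightarrow> real^'n \<Rightarrow> 'n tensor" where
  "nabla u x = (\<lambda>I. partial u I x)"

definition tensor_inner :: "nat \<Rightarrow> ('n::finite) tensor \<Rightarrow> 'n tensor \<Rightarrow> real" where
  "tensor_inner s A B = (\<Sum>I | length I = s. A I * B I)"

definition tensor_prod :: "(real^'n) list \<Rightarrow> 'n tensor" where
  "tensor_prod ws = (\<lambda>I. \<Prod>p<length ws. (ws ! p) $ (I ! p))"

definition tensor_power :: "(real^'n) list \<Rightarrow> (nat \<Rightarrow> nat) \<Rightarrow> 'n tensor" where
  "tensor_power ns \<gamma> = tensor_prod (concat (map (\<lambda>i. replicate (\<gamma> i) (ns ! i)) [0..<length ns]))"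

definition mixed_deriv ::
    "(real^'n \<Rightarrow> real) \<Rightarrow> (real^'n) list \<Rightarrow> (nat \<Rightarrow> nat) \<Rightarrow> real^'n \<Rightarrow> real" where
  "mixed_deriv u ns \<gamma> x = tensor_inner (\<Sum>i<length ns. \<gamma> i) (nabla u x) (tensor_power ns \<gamma>)"

definition tangent_space :: "(nat \<Rightarrow> real^'n) \<Rightarrow> nat set \<Rightarrow> (real^'n) set" where
  "tangent_space v f = span {v a - v b | a b. a \<in> f \<and> b \<in> f}"

definition ortho_proj :: "(real^'n) set \<Rightarrow> real^'n \<Rightarrow> real^'n" where
  "ortho_proj W x = (THE p. p \<in> W \<and> (\<forall>w\<in>W. (x - p) \<bullet> w = 0))"

text \<open>The gradient of a barycentric coordinate is constant; it is evaluated at \<open>0\<close>.\<close>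

definition proj_grad :: "(nat \<Rightarrow> real^'n) \<Rightarrow> nat set \<Rightarrow> nat \<Rightarrow> real^'n" where
  "proj_grad v f i = ortho_proj (tangent_space v (f \<union> {i})) (gradient (bary v i) 0)"

definition normal_basis :: "(nat \<Rightarrow> real^'n) \<Rightarrow> nat set \<Rightarrow> (real^'n) list" where
  "normal_basis v f =
     map (\<lambda>i. proj_grad v f i /\<^sub>R (norm (proj_grad v f i))\<^sup>2) (sorted_list_of_set (opposite CARD('n) f))"

section \<open>The functionals and the matrix\<close>

definition Lfun ::
    "(nat \<Rightarrow> real^'n) \<Rightarrow> nat set \<Rightarrow> (nat \<Rightarrow> nat) \<Rightarrow> (real^'n \<Rightarrow> real) \<Rightarrow> real" where
  "Lfun v f \<alpha> u = bernstein_dual v f (\<Sum>i\<in>f. \<alpha> i) (restr_index \<alpha> f)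
     (restr (subsimplex v f) (mixed_deriv u (normal_basis v f) (restr_index \<alpha> (opposite CARD('n) f))))"

definition Dmat ::
    "(nat \<Rightarrow> real^'n) \<Rightarrow> nat \<Rightarrow> (nat \<Rightarrow> nat) \<Rightarrow> (nat \<Rightarrow> nat) \<Rightarrow> (nat \<Rightarrow> nat) \<Rightarrow> real" where
  "Dmat v k r \<alpha> \<beta> = Lfun v (simplex_of CARD('n) k r \<alpha>) \<alpha> (bernstein v k \<beta>)"

text \<open>Matrices indexed by a finite set \<open>A\<close> are functions of two arguments, considered on \<open>A \<times> A\<close>.\<close>

definition invertible_on :: "'a set \<Rightarrow> ('a \<Rightarrow> 'a \<Rightarrow> real) \<Rightarrow> bool" where
  "invertible_on A M \<longleftrightarrow> (\<exists>N. \<forall>\<alpha>\<in>A. \<forall>\<beta>\<in>A.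
      (\<Sum>\<gamma>\<in>A. M \<alpha> \<gamma> * N \<gamma> \<beta>) = (if \<alpha> = \<beta> then 1 else 0) \<and>
      (\<Sum>\<gamma>\<in>A. N \<alpha> \<gamma> * M \<gamma> \<beta>) = (if \<alpha> = \<beta> then 1 else 0))"

text \<open>The index set \<open>A\<close> is split into the blocks \<open>Bl b\<close>, \<open>b \<in> J\<close> (some of which may be empty), and
  \<open>(b, b') \<in> R\<close> means that block \<open>b\<close> strictly precedes block \<open>b'\<close>.\<close>

definition block_lower_triangular ::
    "'a set \<Rightarrow> 'b set \<Rightarrow> ('b \<Rightarrow> 'a set) \<Rightarrow> ('b \<times> 'b) set \<Rightarrow> ('a \<Rightarrow> 'a \<Rightarrow> real) \<Rightarrow> bool" where
  "block_lower_triangular A J Bl R M \<longleftrightarrow>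
     A = (\<Union>b\<in>J. Bl b) \<and> disjoint_family_on Bl J \<and>
     (\<forall>b\<in>J. \<forall>b'\<in>J. (b, b') \<in> R \<longrightarrow> (\<forall>\<alpha>\<in>Bl b. \<forall>\<beta>\<in>Bl b'. M \<alpha> \<beta> = 0))"

definition block_indices :: "nat \<Rightarrow> (nat \<Rightarrow> nat) \<Rightarrow> (nat \<times> nat set \<times> nat) set" where
  "block_indices d r = {(l, f, s). l \<le> d \<and> f \<in> Delta l {0..d} \<and> s \<le> r l}"

definition block :: "nat \<Rightarrow> nat \<Rightarrow> (nat \<Rightarrow> nat) \<Rightarrow> nat \<times> nat set \<times> nat \<Rightarrow> (nat \<Rightarrow> nat) set" where
  "block d k r = (\<lambda>(l, f, s). Sset d k r l f \<inter> Lset d k f s)"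

text \<open>Here \<open>ord l\<close> is a (reflexive) linear order of the \<open>l\<close>-dimensional sub-simplices.\<close>

definition block_order ::
    "(nat \<Rightarrow> (nat set \<times> nat set) set) \<Rightarrow> ((nat \<times> nat set \<times> nat) \<times> (nat \<times> nat set \<times> nat)) set" where
  "block_order ord = {((l, f, s), (l', f', s')).
     l < l' \<or> (l = l' \<and> ((f \<noteq> f' \<and> (f, f') \<in> ord l) \<or> (f = f' \<and> s < s')))}"

end

theory Submission
  imports Defs
begin

text \<open>
  Differentiating \<open>B\<^sup>\<beta>\<close> along the vectors of \<open>n\<^sub>f\<close> acts on the
  barycentric coordinates off \<open>f\<close> as partial differentiation, because \<open>n\<^sub>f\<close> is dual to the gradients
  of these coordinates (\<open>normal_vector_dual\<close>).  These coordinates vanish on \<open>f\<close>, and the part of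
  \<open>B\<^sup>\<beta>\<close> that lies off \<open>f\<close> has degree \<open>dist(\<beta>, f)\<close>; hence \<open>s = dist(\<alpha>, f)\<close> derivatives give zero
  on \<open>f\<close> whenever \<open>s < dist(\<beta>, f)\<close>.  When \<open>s = dist(\<beta>, f)\<close> they give zero unless \<open>\<alpha>\<close> and \<open>\<beta>\<close>
  agree off \<open>f\<close>, and then \<open>k!/(k - s)!\<close> times the Bernstein polynomial of \<open>f\<close> with index \<open>\<beta>\<^sub>f\<close>, on
  which the dual functional is a Kronecker delta.  Both cases are contained in \<open>Lfun_bernstein\<close>: if
  \<open>dist(\<alpha>, f) \<le> dist(\<beta>, f)\<close>, the entry is zero off the diagonal and \<open>k!/(k - s)!\<close> on it.

  It remains to see that \<open>dist(\<alpha>, f) \<le> dist(\<beta>, f)\<close> holds when the block of \<open>\<beta>\<close> does not precede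
  that of \<open>\<alpha>\<close>.  Within one \<open>S(f)\<close> this is the order by \<open>s\<close>.  If \<open>\<beta>\<close> belongs to another
  sub-simplex \<open>f'\<close> of at least the same dimension, then \<open>\<beta>\<close> is not even within \<open>r\<^sub>\<ell>\<close> of \<open>f\<close>, by
  \<open>Sset_avoids_Dset\<close>, where the doubling condition on \<open>r\<close> enters.  This also makes the sets \<open>S(f)\<close>
  disjoint.  A matrix that is triangular for a ranking of its indices, with nonzero diagonal and
  diagonal on each rank, is invertible (\<open>invertible_on_triangular\<close>).

  The dual functionals are meaningful only because the Bernstein polynomials of \<open>f\<close> form a basis of
  the polynomials on \<open>f\<close>, which is proved by writing Cartesian coordinates as linear forms in
  barycentric ones (\<open>monomial_on_face\<close>) and by Kronecker substitution
  (\<open>homogeneous_independent\<close>).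
\<close>

section \<open>The partition of the simplicial lattice\<close>

lemma finite_opposite [simp]: "finite (opposite d f)"
  by (simp add: opposite_def)

lemma Delta_finite: "f \<in> Delta l {0..d} \<Longrightarrow> finite f"
  by (auto simp: Delta_def intro: finite_subset)

lemma Delta_dim_le: "f \<in> Delta l {0..d} \<Longrightarrow> l \<le> d"
  using card_mono[of "{0..d}" f] by (auto simp: Delta_def)

lemma Delta_top: "f \<in> Delta d {0..d} \<Longrightarrow> f = {0..d}"
  using card_subset_eq[of "{0..d}" f] by (auto simp: Delta_def)

lemma sum_split_opposite:
  fixes \<alpha> :: "nat \<Rightarrow> 'b :: comm_monoid_add"
  assumes "f \<subseteq> {0..d}"
  shows "(\<Sum>i\<le>d. \<alpha> i) = (\<Sum>i\<in>f. \<alpha> i) + (\<Sum>i\<in>opposite d f. \<alpha> i)"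
  using sum.subset_diff[OF assms, of \<alpha>] by (simp add: opposite_def atMost_atLeast0 add.commute)

lemma prod_split_opposite:
  fixes \<alpha> :: "nat \<Rightarrow> 'b :: comm_monoid_mult"
  assumes "f \<subseteq> {0..d}"
  shows "(\<Prod>i\<le>d. \<alpha> i) = (\<Prod>i\<in>f. \<alpha> i) * (\<Prod>i\<in>opposite d f. \<alpha> i)"
  using prod.subset_diff[OF assms, of \<alpha>] by (simp add: opposite_def atMost_atLeast0 mult.commute)

lemma lattice_sum_face:
  assumes "f \<subseteq> {0..d}" "\<alpha> \<in> lattice d k"
  shows "(\<Sum>i\<in>f. \<alpha> i) + ldist d \<alpha> f = k"
  using sum_split_opposite[OF assms(1), of \<alpha>] assms(2) by (simp add: lattice_def ldist_def)

lemma restr_index_eq_iff: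
  assumes "finite f"
  shows "restr_index \<alpha> f = restr_index \<beta> f \<longleftrightarrow> (\<forall>i\<in>f. \<alpha> i = \<beta> i)"
proof -
  have "(\<forall>i\<in>f. \<alpha> i = \<beta> i) \<longleftrightarrow>
        (\<forall>p<card f. \<alpha> (sorted_list_of_set f ! p) = \<beta> (sorted_list_of_set f ! p))"
    using assms by (metis in_set_conv_nth length_sorted_list_of_set set_sorted_list_of_set)
  then show ?thesis by (auto simp: restr_index_def fun_eq_iff)
qed

lemma bij_betw_sorted_list_of_set:
  "finite f \<Longrightarrow> bij_betw (\<lambda>i. sorted_list_of_set f ! i) {..<card f} f"
  by (rule bij_betw_nth) auto

lemma restr_index_lattice:
  assumes "finite f" "f \<noteq> {}"
  shows "restr_index \<alpha> f \<in> lattice (card f - 1) (\<Sum>i\<in>f. \<alpha> i)"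
proof -
  have "card f > 0" using assms by (simp add: card_gt_0_iff)
  then have "{..card f - 1} = {..<card f}" and "\<forall>i>card f - 1. restr_index \<alpha> f i = 0"
    by (auto simp: restr_index_def)
  moreover have "(\<Sum>i<card f. restr_index \<alpha> f i) = (\<Sum>i\<in>f. \<alpha> i)"
    using sum.reindex_bij_betw[OF bij_betw_sorted_list_of_set[OF assms(1)], of \<alpha>]
    by (simp add: restr_index_def)
  ultimately show ?thesis unfolding lattice_def by simp
qed

lemma radius_antimono:
  fixes r :: "nat \<Rightarrow> nat"
  assumes "r d = 0" "\<forall>l. l + 2 \<le> d \<longrightarrow> 2 * r (l + 1) \<le> r l" "i \<le> j" "j \<le> d"
  shows "r j \<le> r i"
  using assms(3,4)
proof (induction j rule: dec_induct)
  case (step j)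
  have "r (Suc j) \<le> r j"
  proof (cases "Suc j = d")
    case False
    then have "2 * r (j + 1) \<le> r j" using step.prems by (intro assms(2)[rule_format]) simp
    then show ?thesis by simp
  qed (simp add: assms(1))
  also have "r j \<le> r i" using step.prems by (intro step.IH) simp
  finally show ?case .
qed simp

text \<open>The heart of the partition.  If \<open>\<beta>\<close> were close to \<open>f\<close> and to \<open>f'\<close>, the two distances would add
  up to bound its distance to \<open>f \<inter> f'\<close>, and the doubling of the radii makes the neighbourhood
  of this smaller face, which \<open>S(f')\<close> avoids, large enough to contain \<open>\<beta>\<close>.  When \<open>f \<inter> f'\<close> is
  empty, the bound contradicts the size of \<open>k\<close>.\<close>

lemma Sset_avoids_Dset:
  fixes r :: "nat \<Rightarrow> nat"
  assumes rd: "r d = 0" and dbl: "\<forall>l. l + 2 \<le> d \<longrightarrow> 2 * r (l + 1) \<le> r l"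
    and k: "2 * r 0 + 1 \<le> k"
    and f: "f \<in> Delta l {0..d}" and f': "f' \<in> Delta l' {0..d}"
    and ll': "l \<le> l'" and ne: "f \<noteq> f'" and \<beta>: "\<beta> \<in> Sset d k r l' f'"
  shows "r l < ldist d \<beta> f"
proof (rule ccontr)
  assume "\<not> r l < ldist d \<beta> f"
  then have near: "ldist d \<beta> f \<le> r l" by simp
  have l'd: "l' \<le> d" using Delta_dim_le[OF f'] .
  have ld: "l < d"
  proof (rule ccontr)
    assume "\<not> l < d"
    then have "l = d" "l' = d" using ll' l'd by auto
    then show False using ne Delta_top f f' by metis
  qed
  have lat: "\<beta> \<in> lattice d k" and near': "ldist d \<beta> f' \<le> r l'"
    and avoid: "\<And>i e. i < l' \<Longrightarrow> e \<in> Delta i f' \<Longrightarrow> r i < ldist d \<beta> e"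
    using \<beta> by (auto simp: Sset_def Dset_def not_le)
  define e where "e = f \<inter> f'"
  have "opposite d e = opposite d f \<union> opposite d f'" by (auto simp: opposite_def e_def)
  then have "ldist d \<beta> e \<le> ldist d \<beta> f + ldist d \<beta> f'"
    using sum.union_inter[of "opposite d f" "opposite d f'" \<beta>] by (simp add: ldist_def)
  moreover have "r l' \<le> r l" using ll' l'd by (rule radius_antimono[OF rd dbl])
  ultimately have near_e: "ldist d \<beta> e \<le> 2 * r l"
    using near near' by simp
  consider "e = {}" | "e = f" | "e \<noteq> {}" "e \<noteq> f" by blast
  then show False
  proof cases
    case 1
    then have "ldist d \<beta> e = k"
      using lattice_sum_face[of "{}" d \<beta> k] lat by simp
    moreover have "r l \<le> r 0" using ld by (intro radius_antimono[OF rd dbl]) simp_all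
    ultimately show False using near_e k by simp
  next
    case 2
    then have sub: "f \<subseteq> f'" by (auto simp: e_def)
    have "card f < card f'"
      using psubset_card_mono[of f' f] Delta_finite[OF f'] sub ne by auto
    then have "l < l'" using f f' by (simp add: Delta_def)
    then show False using avoid[of l f] near f sub by (auto simp: Delta_def)
  next
    case 3
    have "e \<subset> f" using 3 by (auto simp: e_def)
    then have "card e < l + 1" "0 < card e"
      using psubset_card_mono[of f e] Delta_finite[OF f] f 3
      by (auto simp: Delta_def card_gt_0_iff intro: finite_subset)
    then obtain i where i: "card e = i + 1" "i < l"
      by (metis Suc_eq_plus1 Suc_less_eq not0_implies_Suc less_not_refl)
    have "2 * r l \<le> r (l - 1)" using dbl[rule_format, of "l - 1"] i ld by simp
    also have "\<dots> \<le> r i" using i ld by (intro radius_antimono[OF rd dbl]) simp_all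
    finally have "ldist d \<beta> e \<le> r i" using near_e by simp
    moreover have "e \<in> Delta i f'" using i by (auto simp: Delta_def e_def)
    ultimately show False using avoid[of i e] i ll' by simp
  qed
qed

lemma Sset_unique:
  fixes r :: "nat \<Rightarrow> nat"
  assumes rd: "r d = 0" and dbl: "\<forall>l. l + 2 \<le> d \<longrightarrow> 2 * r (l + 1) \<le> r l"
    and k: "2 * r 0 + 1 \<le> k"
    and f: "f \<in> Delta l {0..d}" "\<alpha> \<in> Sset d k r l f"
    and f': "f' \<in> Delta l' {0..d}" "\<alpha> \<in> Sset d k r l' f'"
  shows "f = f'"
proof (rule ccontr)
  assume ne: "f \<noteq> f'"
  have "ldist d \<alpha> f \<le> r l" "ldist d \<alpha> f' \<le> r l'"
    using f f' by (auto simp: Sset_def Dset_def)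
  then show False
    using Sset_avoids_Dset[OF rd dbl k f(1) f'(1) _ ne f'(2)]
      Sset_avoids_Dset[OF rd dbl k f'(1) f(1) _ ne[symmetric] f(2)] by linarith
qed

lemma simplex_of_eq:
  fixes r :: "nat \<Rightarrow> nat"
  assumes rd: "r d = 0" and dbl: "\<forall>l. l + 2 \<le> d \<longrightarrow> 2 * r (l + 1) \<le> r l"
    and k: "2 * r 0 + 1 \<le> k"
    and f: "f \<in> Delta l {0..d}" "\<alpha> \<in> Sset d k r l f"
  shows "simplex_of d k r \<alpha> = f"
  unfolding simplex_of_def
proof (rule the_equality)
  show "\<exists>l\<le>d. f \<in> Delta l {0..d} \<and> \<alpha> \<in> Sset d k r l f"
    using f Delta_dim_le by blast
next
  fix g assume "\<exists>l\<le>d. g \<in> Delta l {0..d} \<and> \<alpha> \<in> Sset d k r l g"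
  then show "g = f" using Sset_unique[OF rd dbl k _ _ f] by blast
qed

text \<open>Every multi-index is at distance \<open>0\<close> from the whole simplex; a face of least dimension
  whose neighbourhood contains it is the one to which it belongs.\<close>

lemma Sset_cover:
  fixes r :: "nat \<Rightarrow> nat"
  assumes \<alpha>: "\<alpha> \<in> lattice d k"
  obtains l f where "l \<le> d" "f \<in> Delta l {0..d}" "\<alpha> \<in> Sset d k r l f"
proof -
  define P where "P l \<longleftrightarrow> (\<exists>f\<in>Delta l {0..d}. \<alpha> \<in> Dset d k f (r l))" for l
  have "{0..d} \<in> Delta d {0..d}" "\<alpha> \<in> Dset d k {0..d} (r d)"
    using \<alpha> by (auto simp: Delta_def Dset_def ldist_def opposite_def)
  then have Pd: "P d" unfolding P_def by blast
  define l where "l = (LEAST l. P l)"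
  have Pl: "P l" unfolding l_def using Pd by (rule LeastI)
  have min: "\<not> P i" if "i < l" for i
    using that unfolding l_def by (rule not_less_Least)
  obtain f where f: "f \<in> Delta l {0..d}" "\<alpha> \<in> Dset d k f (r l)"
    using Pl by (auto simp: P_def)
  have "\<alpha> \<notin> Dset d k e (r i)" if "i < l" "e \<in> Delta i f" for i e
  proof -
    have "e \<in> Delta i {0..d}" using that f(1) by (auto simp: Delta_def)
    then show ?thesis using min[OF that(1)] by (auto simp: P_def)
  qed
  then have "\<alpha> \<in> Sset d k r l f" using f(2) by (auto simp: Sset_def)
  then show thesis using that f(1) Delta_dim_le by blast
qed

section \<open>Inverting a triangular matrix\<close>

text \<open>Order the indices by a rank \<open>h\<close>, ties being harmless because the matrix is diagonal on each
  level of \<open>h\<close>.  Appending an index of largest rank adds one row below and a column that is zero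
  except on the diagonal, so the inverse can be extended explicitly.\<close>

lemma invertible_on_triangular:
  fixes h :: "'a \<Rightarrow> nat" and M :: "'a \<Rightarrow> 'a \<Rightarrow> real"
  assumes "finite A" and "\<And>\<alpha>. \<alpha> \<in> A \<Longrightarrow> M \<alpha> \<alpha> \<noteq> 0"
    and "\<And>\<alpha> \<beta>. \<alpha> \<in> A \<Longrightarrow> \<beta> \<in> A \<Longrightarrow> \<alpha> \<noteq> \<beta> \<Longrightarrow> h \<alpha> \<le> h \<beta> \<Longrightarrow> M \<alpha> \<beta> = 0"
  shows "invertible_on A M"
  using assms
proof (induction A rule: finite_ranking_induct[where f = h])
  case empty
  then show ?case by (simp add: invertible_on_def)
next
  case (insert x S)
  show ?case
  proof (cases "x \<in> S")
    case True
    then show ?thesis using insert by (simp add: insert_absorb)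
  next
    case False
    have "invertible_on S M" using insert.prems by (intro insert.IH) simp_all
    then obtain N where "\<forall>\<alpha>\<in>S. \<forall>\<beta>\<in>S.
        (\<Sum>\<gamma>\<in>S. M \<alpha> \<gamma> * N \<gamma> \<beta>) = (if \<alpha> = \<beta> then 1 else 0) \<and>
        (\<Sum>\<gamma>\<in>S. N \<alpha> \<gamma> * M \<gamma> \<beta>) = (if \<alpha> = \<beta> then 1 else 0)"
      unfolding invertible_on_def by (elim exE)
    then have MN: "(\<Sum>\<gamma>\<in>S. M \<alpha> \<gamma> * N \<gamma> \<beta>) = (if \<alpha> = \<beta> then 1 else 0)"
      and NM: "(\<Sum>\<gamma>\<in>S. N \<alpha> \<gamma> * M \<gamma> \<beta>) = (if \<alpha> = \<beta> then 1 else 0)"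
      if "\<alpha> \<in> S" "\<beta> \<in> S" for \<alpha> \<beta>
      using that by simp_all
    have xx: "M x x \<noteq> 0" using insert.prems by simp
    have col: "M \<alpha> x = 0" if "\<alpha> \<in> S" for \<alpha>
      using insert.prems(2)[of \<alpha> x] insert.hyps(2)[OF that] that False by auto
    define N' where "N' \<alpha> \<beta> =
      (if \<alpha> = x then if \<beta> = x then 1 / M x x else - (\<Sum>\<gamma>\<in>S. M x \<gamma> * N \<gamma> \<beta>) / M x x
       else if \<beta> = x then 0 else N \<alpha> \<beta>)" for \<alpha> \<beta>
    have N'S: "N' \<alpha> \<beta> = N \<alpha> \<beta>" if "\<alpha> \<in> S" "\<beta> \<in> S" for \<alpha> \<beta>
      using that False by (auto simp: N'_def)
    have N'x: "N' \<alpha> x = 0" if "\<alpha> \<in> S" for \<alpha> using that False by (auto simp: N'_def)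
    have N'r: "N' x \<beta> = - (\<Sum>\<gamma>\<in>S. M x \<gamma> * N \<gamma> \<beta>) / M x x" if "\<beta> \<in> S" for \<beta>
      using that False by (auto simp: N'_def)
    have N'xx: "N' x x = 1 / M x x" by (simp add: N'_def)
    have "(\<Sum>\<gamma>\<in>insert x S. M \<alpha> \<gamma> * N' \<gamma> \<beta>) = (if \<alpha> = \<beta> then 1 else 0) \<and>
          (\<Sum>\<gamma>\<in>insert x S. N' \<alpha> \<gamma> * M \<gamma> \<beta>) = (if \<alpha> = \<beta> then 1 else 0)"
      if ab: "\<alpha> \<in> insert x S" "\<beta> \<in> insert x S" for \<alpha> \<beta>
    proof -
      consider "\<alpha> = x" "\<beta> = x" | "\<alpha> = x" "\<beta> \<in> S" | "\<alpha> \<in> S" "\<beta> = x" | "\<alpha> \<in> S" "\<beta> \<in> S"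
        using ab by blast
      then show ?thesis
      proof cases
        case 1
        then show ?thesis using insert.hyps(1) False xx by (simp add: N'x col N'xx)
      next
        case 2
        have "(\<Sum>\<gamma>\<in>S. N' x \<gamma> * M \<gamma> \<beta>)
            = - (\<Sum>\<gamma>\<in>S. \<Sum>\<delta>\<in>S. M x \<delta> * (N \<delta> \<gamma> * M \<gamma> \<beta>)) / M x x"
          by (simp add: N'r sum_distrib_right sum_divide_distrib sum_negf mult.assoc)
        also have "\<dots> = - (\<Sum>\<delta>\<in>S. M x \<delta> * (\<Sum>\<gamma>\<in>S. N \<delta> \<gamma> * M \<gamma> \<beta>)) / M x x"
          by (subst sum.swap) (simp add: sum_distrib_left)
        also have "\<dots> = - (\<Sum>\<delta>\<in>S. if \<delta> = \<beta> then M x \<delta> else 0) / M x x"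
          using 2 by (simp add: NM if_distrib cong: if_cong)
        also have "\<dots> = - M x \<beta> / M x x" using 2 insert.hyps(1) by simp
        finally show ?thesis
          using 2 insert.hyps(1) False xx by (auto simp: N'S N'r N'xx)
      next
        case 3
        then show ?thesis using insert.hyps(1) False by (auto simp: N'x col)
      next
        case 4
        then show ?thesis using insert.hyps(1) False by (auto simp: N'x N'S col MN NM)
      qed
    qed
    then show ?thesis unfolding invertible_on_def by blast
  qed
qed

section \<open>Finite-dimensional function spaces and their dual bases\<close>

definition lincomb :: "'a set \<Rightarrow> ('a \<Rightarrow> 'b \<Rightarrow> real) \<Rightarrow> ('b \<Rightarrow> real) set" where
  "lincomb I M = {p. \<exists>c. p = (\<lambda>x. \<Sum>a\<in>I. c a * M a x)}"

lemma lincomb_memI: "(\<lambda>x. \<Sum>a\<in>I. c a * M a x) \<in> lincomb I M"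
  unfolding lincomb_def by blast

lemma lincomb_zero: "(\<lambda>x. 0) \<in> lincomb I M"
  using lincomb_memI[of "\<lambda>_. 0" M I] by simp

lemma lincomb_add:
  assumes "p \<in> lincomb I M" "q \<in> lincomb I M"
  shows "(\<lambda>x. p x + q x) \<in> lincomb I M"
proof -
  from assms obtain c c' where "p = (\<lambda>x. \<Sum>a\<in>I. c a * M a x)" "q = (\<lambda>x. \<Sum>a\<in>I. c' a * M a x)"
    unfolding lincomb_def by blast
  then have "(\<lambda>x. p x + q x) = (\<lambda>x. \<Sum>a\<in>I. (c a + c' a) * M a x)"
    by (simp add: distrib_right sum.distrib)
  then show ?thesis by (simp add: lincomb_memI)
qed

lemma lincomb_scale:
  assumes "p \<in> lincomb I M"
  shows "(\<lambda>x. t * p x) \<in> lincomb I M"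
proof -
  from assms obtain c where "p = (\<lambda>x. \<Sum>a\<in>I. c a * M a x)"
    unfolding lincomb_def by blast
  then have "(\<lambda>x. t * p x) = (\<lambda>x. \<Sum>a\<in>I. (t * c a) * M a x)"
    by (simp add: sum_distrib_left mult.assoc)
  then show ?thesis by (simp add: lincomb_memI)
qed

lemma lincomb_sum:
  assumes "finite J" "\<And>j. j \<in> J \<Longrightarrow> p j \<in> lincomb I M"
  shows "(\<lambda>x. \<Sum>j\<in>J. p j x) \<in> lincomb I M"
  using assms
proof (induction J rule: finite_induct)
  case empty
  then show ?case by (simp add: lincomb_zero)
next
  case (insert j J)
  then have "(\<lambda>x. p j x + (\<Sum>j\<in>J. p j x)) \<in> lincomb I M"
    by (intro lincomb_add) simp_all
  then show ?case using insert by simp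
qed

lemma lincomb_base:
  assumes "finite I" "a \<in> I"
  shows "M a \<in> lincomb I M"
proof -
  have "M a = (\<lambda>x. \<Sum>b\<in>I. (if b = a then 1 else 0) * M b x)"
    using assms by (auto simp: if_distrib[of "\<lambda>t. t * _"] cong: if_cong)
  then show ?thesis using lincomb_memI[of _ M I] by metis
qed

text \<open>Multiplication by \<open>h\<close> is linear, so where it sends the generators decides where it sends
  the whole space; \<open>h = 1\<close> gives the inclusion of spans.\<close>

lemma lincomb_mult:
  assumes "finite I" "p \<in> lincomb I M"
    and "\<And>a. a \<in> I \<Longrightarrow> (\<lambda>x. h x * M a x) \<in> lincomb J M'"
  shows "(\<lambda>x. h x * p x) \<in> lincomb J M'"
proof -
  from assms(2) obtain c where "p = (\<lambda>x. \<Sum>a\<in>I. c a * M a x)"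
    unfolding lincomb_def by blast
  then have "(\<lambda>x. h x * p x) = (\<lambda>x. \<Sum>a\<in>I. c a * (h x * M a x))"
    by (simp add: sum_distrib_left mult.left_commute)
  also have "\<dots> \<in> lincomb J M'"
    using assms by (intro lincomb_sum lincomb_scale) auto
  finally show ?thesis .
qed

lemma lincomb_mono:
  assumes "finite I" "\<And>a. a \<in> I \<Longrightarrow> M a \<in> lincomb J M'"
  shows "lincomb I M \<subseteq> lincomb J M'"
  using lincomb_mult[of I _ M "\<lambda>_. 1" J M'] assms by auto

lemma lincomb_rescale:
  assumes "finite I" "\<And>a. a \<in> I \<Longrightarrow> t a \<noteq> 0"
  shows "lincomb I (\<lambda>a x. t a * M a x) = lincomb I M"
proof
  show "lincomb I (\<lambda>a x. t a * M a x) \<subseteq> lincomb I M"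
    using assms(1) by (intro lincomb_mono lincomb_scale lincomb_base) auto
  show "lincomb I M \<subseteq> lincomb I (\<lambda>a x. t a * M a x)"
  proof (rule lincomb_mono[OF assms(1)])
    fix a assume a: "a \<in> I"
    have "(\<lambda>x. (1 / t a) * (t a * M a x)) \<in> lincomb I (\<lambda>a x. t a * M a x)"
      using lincomb_base[OF assms(1) a, of "\<lambda>a x. t a * M a x"] by (rule lincomb_scale)
    then show "M a \<in> lincomb I (\<lambda>a x. t a * M a x)" using assms(2)[OF a] by simp
  qed
qed

lemma dual_space_zero:
  assumes "b \<in> dual_space P" "(\<lambda>x. 0) \<in> P"
  shows "b (\<lambda>x. 0) = 0"
proof -
  have "\<forall>c. \<forall>p\<in>P. b (\<lambda>x. c * p x) = c * b p"
    using assms(1) by (simp add: dual_space_def)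
  from bspec[OF spec[OF this, of 0] assms(2)] show ?thesis by simp
qed

lemma dual_space_lincomb:
  assumes "finite I" and b: "b \<in> dual_space (lincomb I M)"
  shows "b (\<lambda>x. \<Sum>a\<in>I. c a * M a x) = (\<Sum>a\<in>I. c a * b (M a))"
proof -
  have add: "b (\<lambda>x. p x + q x) = b p + b q" if "p \<in> lincomb I M" "q \<in> lincomb I M" for p q
    using b that by (simp add: dual_space_def)
  have scale: "b (\<lambda>x. t * p x) = t * b p" if "p \<in> lincomb I M" for p t
    using b that by (simp add: dual_space_def)
  have "b (\<lambda>x. \<Sum>a\<in>J. c a * M a x) = (\<Sum>a\<in>J. c a * b (M a))" if "J \<subseteq> I" for J
    using finite_subset[OF that assms(1)] that
  proof (induction J rule: finite_induct)
    case empty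
    then show ?case using dual_space_zero[OF b lincomb_zero] by simp
  next
    case (insert a J)
    have "M a \<in> lincomb I M" using insert.prems assms(1) by (intro lincomb_base) auto
    moreover have "(\<lambda>x. \<Sum>a\<in>J. c a * M a x) \<in> lincomb I M"
      using insert assms(1) by (intro lincomb_sum lincomb_scale lincomb_base) auto
    ultimately have "b (\<lambda>x. c a * M a x + (\<Sum>a\<in>J. c a * M a x))
        = c a * b (M a) + b (\<lambda>x. \<Sum>a\<in>J. c a * M a x)"
      by (simp add: add lincomb_scale scale)
    then show ?case using insert by simp
  qed
  then show ?thesis by blast
qed

text \<open>Independence makes coordinates well defined; the functional dual to \<open>M \<mu>\<close> reads off the
  coordinate at \<open>\<mu>\<close>, and linearity leaves no other choice.\<close>

lemma dual_basis_exists_unique: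
  assumes fin: "finite I" and \<mu>: "\<mu> \<in> I"
    and indep: "\<And>c. (\<And>x. (\<Sum>a\<in>I. c a * M a x) = 0) \<Longrightarrow> \<forall>a\<in>I. c a = 0"
  shows "\<exists>!b. b \<in> dual_space (lincomb I M) \<and> (\<forall>\<nu>\<in>I. b (M \<nu>) = (if \<mu> = \<nu> then 1 else 0))"
proof -
  define P where "P = lincomb I M"
  define coord where
    "coord p = (SOME c. p = (\<lambda>x. \<Sum>a\<in>I. c a * M a x))" for p :: "'b \<Rightarrow> real"
  define b where "b p = (if p \<in> P then coord p \<mu> else 0)" for p
  have coord: "p = (\<lambda>x. \<Sum>a\<in>I. coord p a * M a x)" if "p \<in> P" for p
  proof -
    from that have "\<exists>c. p = (\<lambda>x. \<Sum>a\<in>I. c a * M a x)" by (simp add: P_def lincomb_def)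
    then show ?thesis unfolding coord_def by (rule someI_ex)
  qed
  have b_eq: "b (\<lambda>x. \<Sum>a\<in>I. c a * M a x) = c \<mu>" for c
  proof -
    define p where "p = (\<lambda>x. \<Sum>a\<in>I. c a * M a x)"
    have pP: "p \<in> P" unfolding p_def P_def by (rule lincomb_memI)
    have "(\<Sum>a\<in>I. (coord p a - c a) * M a x) = 0" for x
      using fun_cong[OF coord[OF pP], of x] p_def by (simp add: left_diff_distrib sum_subtractf)
    then have "\<forall>a\<in>I. coord p a - c a = 0" by (rule indep)
    then show ?thesis using \<mu> pP by (simp add: b_def p_def)
  qed
  have "b (\<lambda>x. p x + q x) = b p + b q" if "p \<in> P" "q \<in> P" for p q
  proof -
    have "(\<lambda>x. p x + q x) = (\<lambda>x. \<Sum>a\<in>I. (coord p a + coord q a) * M a x)"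
      using fun_cong[OF coord[OF that(1)]] fun_cong[OF coord[OF that(2)]]
      by (simp add: distrib_right sum.distrib)
    then show ?thesis using b_eq that by (simp add: b_def)
  qed
  moreover have "b (\<lambda>x. t * p x) = t * b p" if "p \<in> P" for p t
  proof -
    have "(\<lambda>x. t * p x) = (\<lambda>x. t * (\<Sum>a\<in>I. coord p a * M a x))"
      using fun_cong[OF coord[OF that]] by simp
    then have "(\<lambda>x. t * p x) = (\<lambda>x. \<Sum>a\<in>I. (t * coord p a) * M a x)"
      by (simp add: sum_distrib_left mult.assoc)
    then show ?thesis using b_eq that by (simp add: b_def)
  qed
  ultimately have dual: "b \<in> dual_space P"
    by (simp add: dual_space_def b_def)
  have "b (M \<nu>) = (if \<mu> = \<nu> then 1 else 0)" if "\<nu> \<in> I" for \<nu>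
  proof -
    have "M \<nu> = (\<lambda>x. \<Sum>a\<in>I. (if a = \<nu> then 1 else 0) * M a x)"
      using fin that by (auto simp: if_distrib[of "\<lambda>t. t * _"] cong: if_cong)
    then have "b (M \<nu>) = b (\<lambda>x. \<Sum>a\<in>I. (if a = \<nu> then 1 else 0) * M a x)"
      by (rule arg_cong)
    then show ?thesis by (simp only: b_eq)
  qed
  moreover have "b' = b"
    if b': "b' \<in> dual_space P" "\<forall>\<nu>\<in>I. b' (M \<nu>) = (if \<mu> = \<nu> then 1 else 0)" for b'
  proof
    fix p
    show "b' p = b p"
    proof (cases "p \<in> P")
      case True
      have "b' p = b' (\<lambda>x. \<Sum>a\<in>I. coord p a * M a x)"
        using coord[OF True] by (rule arg_cong)
      also have "\<dots> = (\<Sum>a\<in>I. coord p a * b' (M a))"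
        using fin b'(1)[unfolded P_def] by (rule dual_space_lincomb)
      also have "\<dots> = (\<Sum>a\<in>I. if \<mu> = a then coord p a else 0)"
        using b'(2) by (intro sum.cong) auto
      also have "\<dots> = b p" using fin \<mu> True by (simp add: b_def)
      finally show ?thesis .
    next
      case False
      then show ?thesis using b'(1) by (simp add: dual_space_def b_def)
    qed
  qed
  ultimately show ?thesis using dual unfolding P_def by blast
qed

section \<open>Independence of homogeneous monomials\<close>

lemma lattice_component_le: "\<alpha> \<in> lattice n j \<Longrightarrow> \<alpha> i \<le> j"
  using member_le_sum[of i "{..n}" \<alpha>] by (cases "i \<le> n") (auto simp: lattice_def)

lemma finite_lattice: "finite (lattice n j)"
proof (rule finite_subset)
  show "lattice n j \<subseteq> {\<alpha>. \<forall>i. (i \<in> {..n} \<longrightarrow> \<alpha> i \<in> {..j}) \<and> (i \<notin> {..n} \<longrightarrow> \<alpha> i = 0)}"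
    using lattice_component_le by (auto simp: lattice_def)
  show "finite {\<alpha>. \<forall>i. (i \<in> {..n} \<longrightarrow> \<alpha> i \<in> {..j}) \<and> (i \<notin> {..n} \<longrightarrow> \<alpha> i = (0::nat))}"
    by (intro finite_set_of_finite_funs) auto
qed

lemma digits_unique:
  fixes a b :: "nat \<Rightarrow> nat"
  assumes "\<And>i. a i < N" "\<And>i. b i < N" "(\<Sum>i<n. a i * N ^ i) = (\<Sum>i<n. b i * N ^ i)"
  shows "\<forall>i<n. a i = b i"
  using assms
proof (induction n arbitrary: a b)
  case (Suc n)
  have split: "(\<Sum>i<Suc n. c i * N ^ i) = c 0 + N * (\<Sum>i<n. c (Suc i) * N ^ i)" for c :: "nat \<Rightarrow> nat"
    by (simp add: sum.lessThan_Suc_shift sum_distrib_left mult.left_commute del: sum.lessThan_Suc)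
  let ?A = "\<Sum>i<n. a (Suc i) * N ^ i" and ?B = "\<Sum>i<n. b (Suc i) * N ^ i"
  have eq: "a 0 + N * ?A = b 0 + N * ?B"
    using Suc.prems(3) by (simp only: split)
  have "a 0 = b 0"
    using arg_cong[OF eq, of "\<lambda>t. t mod N"] Suc.prems(1,2)[of 0] by simp
  moreover have "?A = ?B"
    using arg_cong[OF eq, of "\<lambda>t. t div N"] Suc.prems(1,2)[of 0] by simp
  then have "\<forall>i<n. a (Suc i) = b (Suc i)"
    using Suc.prems(1,2) by (intro Suc.IH) auto
  ultimately show ?case by (auto simp: less_Suc_eq_0_disj)
qed simp

lemma exponents_independent:
  fixes c :: "'a \<Rightarrow> real"
  assumes "finite I" "inj_on \<phi> I" "\<And>y::real. y > 0 \<Longrightarrow> (\<Sum>a\<in>I. c a * y ^ \<phi> a) = 0" "a \<in> I"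
  shows "c a = 0"
proof -
  define p where "p = (\<Sum>a\<in>I. monom (c a) (\<phi> a))"
  have "{0<..} \<subseteq> {y. poly p y = 0}"
    using assms(3) by (auto simp: p_def poly_sum poly_monom)
  then have "infinite {y. poly p y = 0}"
    using infinite_Ioi finite_subset by blast
  then have "p = 0" using poly_roots_finite by blast
  then have "0 = coeff p (\<phi> a)" by simp
  also have "\<dots> = (\<Sum>b\<in>I. if b = a then c b else 0)"
    unfolding p_def coeff_sum coeff_monom
    using assms(2,4) by (intro sum.cong) (auto dest: inj_onD)
  also have "\<dots> = c a" using assms(1,4) by simp
  finally show ?thesis by simp
qed

text \<open>Kronecker substitution: putting \<open>t i = y ^ (N ^ i)\<close> with \<open>N > j\<close> turns the monomials of
  degree \<open>j\<close> into distinct powers of the one variable \<open>y\<close>, because exponents are then the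
  digits in base \<open>N\<close>.\<close>

lemma homogeneous_independent:
  fixes c :: "(nat \<Rightarrow> nat) \<Rightarrow> real"
  assumes "\<And>t. (\<And>i. t i > 0) \<Longrightarrow> (\<Sum>\<nu>\<in>lattice n j. c \<nu> * (\<Prod>i\<le>n. t i ^ \<nu> i)) = 0"
    and "\<mu> \<in> lattice n j"
  shows "c \<mu> = 0"
proof (rule exponents_independent[OF finite_lattice _ _ assms(2)])
  let ?\<phi> = "\<lambda>\<nu>. \<Sum>i\<le>n. \<nu> i * Suc j ^ i"
  show "inj_on ?\<phi> (lattice n j)"
  proof (rule inj_onI)
    fix \<alpha> \<beta> assume \<alpha>: "\<alpha> \<in> lattice n j" and \<beta>: "\<beta> \<in> lattice n j" and "?\<phi> \<alpha> = ?\<phi> \<beta>"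
    then have "\<forall>i<Suc n. \<alpha> i = \<beta> i"
      by (intro digits_unique[of \<alpha> "Suc j"])
        (auto simp: less_Suc_eq_le lattice_component_le lessThan_Suc_atMost)
    then show "\<alpha> = \<beta>" using \<alpha> \<beta>
      by (intro ext) (metis (mono_tags, lifting) lattice_def less_Suc_eq_le mem_Collect_eq not_le)
  qed
  fix y :: real assume y: "y > 0"
  have "(\<Prod>i\<le>n. (y ^ (Suc j ^ i)) ^ \<nu> i) = y ^ ?\<phi> \<nu>" for \<nu> :: "nat \<Rightarrow> nat"
    by (simp add: power_mult[symmetric] power_sum mult.commute)
  then show "(\<Sum>\<nu>\<in>lattice n j. c \<nu> * y ^ ?\<phi> \<nu>) = 0"
    using assms(1)[of "\<lambda>i. y ^ (Suc j ^ i)"] y by simp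
qed

section \<open>Derivatives of polynomial functions\<close>

definition dir_deriv :: "real^'n \<Rightarrow> (real^'n \<Rightarrow> real) \<Rightarrow> real^'n \<Rightarrow> real" where
  "dir_deriv w u = (\<lambda>x. gradient u x \<bullet> w)"

lemma gradient_eq:
  assumes "GDERIV u x :> D"
  shows "gradient u x = D"
  unfolding gradient_def
proof (rule the_equality[where P = "\<lambda>D. GDERIV u x :> D", OF assms])
  fix D' assume "GDERIV u x :> D'"
  then have "(\<lambda>h. h \<bullet> D') = (\<lambda>h. h \<bullet> D)"
    using assms unfolding gderiv_def by (rule has_derivative_unique)
  then show "D' = D" by (metis vector_eq_ldot)
qed

lemma polynomial_gradient_exists:
  fixes u :: "real^'n \<Rightarrow> real"
  assumes "real_polynomial_function u"
  shows "\<exists>G. (\<forall>x. GDERIV u x :> G x) \<and> (\<forall>w. real_polynomial_function (\<lambda>x. G x \<bullet> w))"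
  using assms
proof (induction u rule: real_polynomial_function.induct)
  case (linear f)
  have "linear f" using linear by (rule bounded_linear.linear)
  then have "f = (\<lambda>h. h \<bullet> adjoint f 1)" by (simp add: adjoint_works fun_eq_iff)
  then have "GDERIV f x :> adjoint f 1" for x
    unfolding gderiv_def using bounded_linear_imp_has_derivative[OF linear] by metis
  then show ?case by (intro exI[of _ "\<lambda>_. adjoint f 1"]) auto
next
  case (const c)
  show ?case by (intro exI[of _ "\<lambda>_. 0"]) (auto intro: GDERIV_const)
next
  case (add f g)
  then obtain F G where "\<forall>x. GDERIV f x :> F x" "\<forall>w. real_polynomial_function (\<lambda>x. F x \<bullet> w)"
    "\<forall>x. GDERIV g x :> G x" "\<forall>w. real_polynomial_function (\<lambda>x. G x \<bullet> w)"
    by blast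
  then show ?case
    by (intro exI[of _ "\<lambda>x. F x + G x"])
      (auto intro!: GDERIV_add real_polynomial_function.intros(3) simp: inner_add_left)
next
  case (mult f g)
  then obtain F G where "\<forall>x. GDERIV f x :> F x" "\<forall>w. real_polynomial_function (\<lambda>x. F x \<bullet> w)"
    "\<forall>x. GDERIV g x :> G x" "\<forall>w. real_polynomial_function (\<lambda>x. G x \<bullet> w)"
    by blast
  then show ?case using mult.hyps
    by (intro exI[of _ "\<lambda>x. f x *\<^sub>R G x + g x *\<^sub>R F x"])
      (auto intro!: GDERIV_mult real_polynomial_function.intros(3,4) simp: inner_add_left)
qed

lemma polynomial_GDERIV:
  assumes "real_polynomial_function u"
  shows "GDERIV u x :> gradient u x"
proof -
  obtain G where "\<forall>x. GDERIV u x :> G x"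
    using polynomial_gradient_exists[OF assms] by blast
  then show ?thesis using gradient_eq by metis
qed

lemma polynomial_dir_deriv:
  assumes "real_polynomial_function u"
  shows "real_polynomial_function (dir_deriv w u)"
proof -
  obtain G where G: "\<forall>x. GDERIV u x :> G x" "\<forall>w. real_polynomial_function (\<lambda>x. G x \<bullet> w)"
    using polynomial_gradient_exists[OF assms] by blast
  have "dir_deriv w u = (\<lambda>x. G x \<bullet> w)"
    using gradient_eq[OF spec[OF G(1)]] by (simp add: dir_deriv_def)
  then show ?thesis using G(2) by simp
qed

lemma dir_deriv_const: "dir_deriv w (\<lambda>x. c) = (\<lambda>x. 0)"
  by (simp add: dir_deriv_def gradient_eq[OF GDERIV_const])

lemma dir_deriv_add:
  assumes "real_polynomial_function u" "real_polynomial_function v"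
  shows "dir_deriv w (\<lambda>x. u x + v x) = (\<lambda>x. dir_deriv w u x + dir_deriv w v x)"
  using gradient_eq[OF GDERIV_add[OF polynomial_GDERIV[OF assms(1)] polynomial_GDERIV[OF assms(2)]]]
  by (simp add: dir_deriv_def inner_add_left)

lemma dir_deriv_mult:
  assumes "real_polynomial_function u" "real_polynomial_function v"
  shows "dir_deriv w (\<lambda>x. u x * v x) = (\<lambda>x. dir_deriv w u x * v x + u x * dir_deriv w v x)"
  using gradient_eq[OF GDERIV_mult[OF polynomial_GDERIV[OF assms(1)] polynomial_GDERIV[OF assms(2)]]]
  by (simp add: dir_deriv_def inner_add_left mult.commute add.commute)

lemma dir_deriv_cmult:
  assumes "real_polynomial_function u"
  shows "dir_deriv w (\<lambda>x. c * u x) = (\<lambda>x. c * dir_deriv w u x)"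
  using dir_deriv_mult[OF real_polynomial_function.intros(2) assms] by (simp add: dir_deriv_const)

lemma dir_deriv_sum:
  assumes "finite J" "\<And>j. j \<in> J \<Longrightarrow> real_polynomial_function (u j)"
  shows "dir_deriv w (\<lambda>x. \<Sum>j\<in>J. u j x) = (\<lambda>x. \<Sum>j\<in>J. dir_deriv w (u j) x)"
  using assms
proof (induction J rule: finite_induct)
  case (insert j J)
  have "real_polynomial_function (\<lambda>x. \<Sum>j\<in>J. u j x)"
    using insert by (intro real_polynomial_function_sum) auto
  then show ?case using insert by (simp add: dir_deriv_add)
qed (simp add: dir_deriv_const)

lemma dir_deriv_power:
  assumes "real_polynomial_function u"
  shows "dir_deriv w (\<lambda>x. u x ^ e) = (\<lambda>x. e * u x ^ (e - 1) * dir_deriv w u x)"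
proof (induction e)
  case (Suc e)
  have "dir_deriv w (\<lambda>x. u x * u x ^ e)
      = (\<lambda>x. dir_deriv w u x * u x ^ e + u x * dir_deriv w (\<lambda>x. u x ^ e) x)"
    using assms by (intro dir_deriv_mult real_polynomial_function_power)
  then show ?case unfolding Suc.IH by (cases e) (simp_all add: algebra_simps)
qed (simp add: dir_deriv_const)

lemma polynomial_foldr_dir_deriv:
  "real_polynomial_function u \<Longrightarrow> real_polynomial_function (foldr dir_deriv ws u)"
  by (induction ws) (auto intro: polynomial_dir_deriv)

lemma foldr_dir_deriv_add:
  assumes "real_polynomial_function u" "real_polynomial_function v"
  shows "foldr dir_deriv ws (\<lambda>x. u x + v x)
    = (\<lambda>x. foldr dir_deriv ws u x + foldr dir_deriv ws v x)"
  using assms by (induction ws) (auto simp: dir_deriv_add polynomial_foldr_dir_deriv)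

lemma foldr_dir_deriv_cmult:
  assumes "real_polynomial_function u"
  shows "foldr dir_deriv ws (\<lambda>x. c * u x) = (\<lambda>x. c * foldr dir_deriv ws u x)"
  using assms by (induction ws) (auto simp: dir_deriv_cmult polynomial_foldr_dir_deriv)

text \<open>The outermost derivative of \<open>partial\<close> belongs to the head of the index list, as it does in
  \<open>foldr\<close>; summing over this first index contracts a gradient with the first vector, which is one
  directional derivative.  A contracted derivative tensor is thus an iterated derivative, to which
  the product rule applies.\<close>

lemma foldr_dir_deriv_tensor:
  fixes u :: "real^'n \<Rightarrow> real"
  assumes u: "real_polynomial_function u"
  shows "foldr dir_deriv ws u
    = (\<lambda>x. \<Sum>I | length I = length ws. partial u I x * (\<Prod>p<length ws. (ws ! p) $ (I ! p)))"
proof (induction ws)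
  case (Cons w ws)
  let ?n = "length ws"
  let ?L = "\<lambda>m. {I :: 'n list. length I = m}"
  have finL: "finite (?L m)" for m using finite_lists_length_eq[of "UNIV :: 'n set" m] by simp
  have pol: "real_polynomial_function (partial u I)" for I
  proof (induction I)
    case (Cons i I)
    have "partial u (i # I) = dir_deriv (axis i 1) (partial u I)"
      by (simp add: dir_deriv_def inner_axis)
    then show ?case using polynomial_dir_deriv[OF Cons] by simp
  qed (simp add: u)
  let ?c = "\<lambda>I. \<Prod>p<?n. (ws ! p) $ (I ! p)"
  have L: "?L (Suc ?n) = (\<lambda>(i, I). i # I) ` (UNIV \<times> ?L ?n)"
    by (auto simp: length_Suc_conv image_iff)
  have inj: "inj_on (\<lambda>(i, I). i # I) (UNIV \<times> ?L ?n)" by (auto simp: inj_on_def)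
  have D: "dir_deriv w (\<lambda>x. ?c I * partial u I x) x
      = (\<Sum>i\<in>UNIV. partial u (i # I) x * (w $ i * ?c I))" for I x
  proof -
    have "dir_deriv w (\<lambda>x. ?c I * partial u I x) x = ?c I * (gradient (partial u I) x \<bullet> w)"
      using fun_cong[OF dir_deriv_cmult[OF pol]] by (simp add: dir_deriv_def)
    then show ?thesis by (simp add: inner_vec_def sum_distrib_left mult_ac)
  qed
  have "foldr dir_deriv (w # ws) u x
      = (\<Sum>I | length I = length (w # ws).
          partial u I x * (\<Prod>p<length (w # ws). ((w # ws) ! p) $ (I ! p)))" for x
  proof -
    have "foldr dir_deriv (w # ws) u x = dir_deriv w (\<lambda>x. \<Sum>I\<in>?L ?n. ?c I * partial u I x) x"
      by (simp add: Cons.IH mult.commute)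
    also have "\<dots> = (\<Sum>I\<in>?L ?n. dir_deriv w (\<lambda>x. ?c I * partial u I x) x)"
      using pol by (subst dir_deriv_sum[OF finL]) auto
    also have "\<dots> = (\<Sum>i\<in>UNIV. \<Sum>I\<in>?L ?n. partial u (i # I) x * (w $ i * ?c I))"
      unfolding D by (rule sum.swap)
    also have "\<dots> = (\<Sum>(i, I)\<in>UNIV \<times> ?L ?n. partial u (i # I) x * (w $ i * ?c I))"
      by (rule sum.cartesian_product)
    also have "\<dots> = (\<Sum>I\<in>?L (Suc ?n).
          partial u I x * (\<Prod>p<Suc ?n. ((w # ws) ! p) $ (I ! p)))"
      unfolding L sum.reindex[OF inj]
      by (intro sum.cong) (auto simp: prod.lessThan_Suc_shift simp del: prod.lessThan_Suc)
    finally show ?thesis by simp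
  qed
  then show ?case by blast
qed simp

lemma mixed_deriv_eq_foldr:
  assumes "real_polynomial_function u"
  shows "mixed_deriv u ns \<gamma> =
    foldr dir_deriv (concat (map (\<lambda>i. replicate (\<gamma> i) (ns ! i)) [0..<length ns])) u"
proof -
  define ws where "ws = concat (map (\<lambda>i. replicate (\<gamma> i) (ns ! i)) [0..<length ns])"
  have "length ws = (\<Sum>i<length ns. \<gamma> i)"
    by (simp add: ws_def length_concat o_def interv_sum_list_conv_sum_set_nat atLeast0LessThan)
  then show ?thesis
    unfolding ws_def[symmetric] foldr_dir_deriv_tensor[OF assms]
    by (simp add: fun_eq_iff mixed_deriv_def tensor_inner_def nabla_def tensor_power_def
        tensor_prod_def ws_def[symmetric])
qed

section \<open>Order of vanishing along a sub-simplex\<close>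

lemma dir_deriv_dual_monomial:
  assumes "finite J" and lam: "\<And>j. j \<in> J \<Longrightarrow> real_polynomial_function (lam j)"
    and dual: "\<And>j. j \<in> J \<Longrightarrow> dir_deriv w (lam j) = (\<lambda>x. if i = j then 1 else 0)"
    and i: "i \<in> J"
  shows "dir_deriv w (\<lambda>x. \<Prod>j\<in>J. lam j x ^ e j)
    = (\<lambda>x. e i * (\<Prod>j\<in>J. lam j x ^ (e(i := e i - 1)) j))"
proof -
  have pol: "real_polynomial_function (\<lambda>x. \<Prod>j\<in>K. lam j x ^ e j)" if "K \<subseteq> J" for K
    using that lam finite_subset[OF that assms(1)]
    by (intro real_polynomial_function_prod real_polynomial_function_power) auto
  have zero: "dir_deriv w (\<lambda>x. \<Prod>j\<in>K. lam j x ^ e j) = (\<lambda>x. 0)"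
    if "finite K" "K \<subseteq> J - {i}" for K
    using that
  proof (induction K rule: finite_induct)
    case empty
    then show ?case by (simp add: dir_deriv_const)
  next
    case (insert j K)
    then have "dir_deriv w (\<lambda>x. lam j x ^ e j) = (\<lambda>x. 0)"
      using lam[of j] dual[of j] by (auto simp: dir_deriv_power)
    moreover have "dir_deriv w (\<lambda>x. lam j x ^ e j * (\<Prod>j\<in>K. lam j x ^ e j))
       = (\<lambda>x. dir_deriv w (\<lambda>x. lam j x ^ e j) x * (\<Prod>j\<in>K. lam j x ^ e j)
            + lam j x ^ e j * dir_deriv w (\<lambda>x. \<Prod>j\<in>K. lam j x ^ e j) x)"
      using insert lam by (intro dir_deriv_mult real_polynomial_function_power pol) auto
    ultimately show ?case using insert by auto
  qed
  let ?R = "\<lambda>x. \<Prod>j\<in>J - {i}. lam j x ^ e j"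
  have "(\<lambda>x. \<Prod>j\<in>J. lam j x ^ e j) = (\<lambda>x. lam i x ^ e i * ?R x)"
    using assms(1) i by (simp add: prod.remove)
  then have "dir_deriv w (\<lambda>x. \<Prod>j\<in>J. lam j x ^ e j)
      = (\<lambda>x. dir_deriv w (\<lambda>x. lam i x ^ e i) x * ?R x + lam i x ^ e i * dir_deriv w ?R x)"
    using lam i by (simp add: dir_deriv_mult real_polynomial_function_power pol)
  also have "\<dots> = (\<lambda>x. e i * (lam i x ^ (e i - 1) * ?R x))"
    using lam[OF i] dual[OF i] zero[of "J - {i}"] assms(1) by (simp add: dir_deriv_power mult.assoc)
  also have "\<dots> = (\<lambda>x. e i * (\<Prod>j\<in>J. lam j x ^ (e(i := e i - 1)) j))"
    using assms(1) i by (simp add: prod.remove)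
  finally show ?thesis .
qed

text \<open>Each derivative along \<open>w i\<close> either falls on the arbitrary factor \<open>A\<close>, leaving the zero of order
  \<open>\<Sum>j. e j\<close> intact, or lowers the exponent of \<open>lam i\<close> by one.  Where all \<open>lam j\<close> vanish, at most
  \<open>\<Sum>j. e j\<close> derivatives can therefore give a nonzero value only when they use up the exponents
  exactly, and then \<open>A\<close> is not differentiated at all.\<close>

lemma dual_derivatives_of_monomial:
  fixes w :: "'a \<Rightarrow> real^'n" and e :: "'a \<Rightarrow> nat"
  assumes J: "finite J" and lam: "\<And>j. j \<in> J \<Longrightarrow> real_polynomial_function (lam j)"
    and dual: "\<And>i j. i \<in> J \<Longrightarrow> j \<in> J \<Longrightarrow> dir_deriv (w i) (lam j) = (\<lambda>x. if i = j then 1 else 0)"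
    and x: "\<And>j. j \<in> J \<Longrightarrow> lam j x = 0"
    and "real_polynomial_function A" "set is \<subseteq> J" "length is \<le> (\<Sum>j\<in>J. e j)"
  shows "foldr dir_deriv (map w is) (\<lambda>x. A x * (\<Prod>j\<in>J. lam j x ^ e j)) x
    = (if \<forall>j\<in>J. count_list is j = e j then (\<Prod>j\<in>J. fact (e j)) * A x else 0)"
  using assms(5-)
proof (induction "is" arbitrary: A e rule: rev_induct)
  case Nil
  show ?case
  proof (cases "\<forall>j\<in>J. e j = 0")
    case False
    then obtain j where "j \<in> J" "e j \<noteq> 0" by blast
    then have "(\<Prod>j\<in>J. lam j x ^ e j) = 0" using J x by (intro prod_zero) auto
    then show ?thesis using False by auto
  qed simp
next
  case (snoc i "is")
  have i: "i \<in> J" and "is": "set is \<subseteq> J" using snoc.prems by auto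
  have pol: "real_polynomial_function (\<lambda>x. \<Prod>j\<in>J. lam j x ^ e j)" for e
    using lam J by (intro real_polynomial_function_prod real_polynomial_function_power) auto
  let ?E = "\<lambda>e x. \<Prod>j\<in>J. lam j x ^ e j"
  let ?e = "e(i := e i - 1)"
  let ?D = "foldr dir_deriv (map w is)"
  have fewer: "\<not> (\<forall>j\<in>J. count_list is j = e j)"
  proof
    assume "\<forall>j\<in>J. count_list is j = e j"
    then have "(\<Sum>j\<in>J. e j) = (\<Sum>j\<in>J. count_list is j)" by simp
    also have "\<dots> = (\<Sum>j\<in>set is. count_list is j)"
      using J "is" by (intro sum.mono_neutral_right) auto
    also have "\<dots> = length is" by (rule sum_count_set) auto
    finally show False using snoc.prems(3) by simp
  qed
  have 1: "?D (\<lambda>x. dir_deriv (w i) A x * ?E e x) x = 0"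
    using snoc.IH[OF polynomial_dir_deriv[OF snoc.prems(1)] "is", of e] snoc.prems(3) fewer
    by simp
  have 2: "e i * ?D (\<lambda>x. A x * ?E ?e x) x
    = (if \<forall>j\<in>J. count_list (is @ [i]) j = e j then (\<Prod>j\<in>J. fact (e j)) * A x else 0)"
  proof (cases "e i = 0")
    case True
    then show ?thesis using i by auto
  next
    case False
    have "(\<Sum>j\<in>J. e j) = Suc (\<Sum>j\<in>J. ?e j)"
      using J i False by (simp add: sum.remove)
    then have "length is \<le> (\<Sum>j\<in>J. ?e j)" using snoc.prems(3) by simp
    then have IH: "?D (\<lambda>x. A x * ?E ?e x) x
        = (if \<forall>j\<in>J. count_list is j = ?e j then (\<Prod>j\<in>J. fact (?e j)) * A x else 0)"
      by (rule snoc.IH[OF snoc.prems(1) "is"])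
    have "e i * (\<Prod>j\<in>J. fact (?e j)) = (\<Prod>j\<in>J. fact (e j) :: real)"
    proof -
      have "(\<Prod>j\<in>J. fact (?e j) :: real) = fact (e i - 1) * (\<Prod>j\<in>J - {i}. fact (e j))"
        using J i by (simp add: prod.remove)
      then show ?thesis
        using J i False by (simp add: prod.remove fact_reduce[of "e i"])
    qed
    moreover have "(\<forall>j\<in>J. count_list is j = ?e j) \<longleftrightarrow> (\<forall>j\<in>J. count_list (is @ [i]) j = e j)"
      using False by auto
    ultimately show ?thesis unfolding IH by (simp add: mult.assoc[symmetric])
  qed
  have "dir_deriv (w i) (\<lambda>x. A x * ?E e x)
      = (\<lambda>x. dir_deriv (w i) A x * ?E e x + e i * (A x * ?E ?e x))"
  proof -
    have "dir_deriv (w i) (?E e) = (\<lambda>x. e i * ?E ?e x)"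
      using J lam dual[OF i] i by (rule dir_deriv_dual_monomial)
    then show ?thesis
      unfolding dir_deriv_mult[OF snoc.prems(1) pol[of e]] by (simp add: mult.left_commute)
  qed
  then have "foldr dir_deriv (map w (is @ [i])) (\<lambda>x. A x * ?E e x) x
      = ?D (\<lambda>x. dir_deriv (w i) A x * ?E e x + e i * (A x * ?E ?e x)) x"
    by simp
  also have "\<dots> = ?D (\<lambda>x. dir_deriv (w i) A x * ?E e x) x + ?D (\<lambda>x. e i * (A x * ?E ?e x)) x"
    by (intro fun_cong[OF foldr_dir_deriv_add] real_polynomial_function.intros(2,4)
        polynomial_dir_deriv snoc.prems(1) pol)
  also have "?D (\<lambda>x. e i * (A x * ?E ?e x)) x = e i * ?D (\<lambda>x. A x * ?E ?e x) x"
    by (intro fun_cong[OF foldr_dir_deriv_cmult] real_polynomial_function.intros(4)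
        snoc.prems(1) pol)
  finally show ?case using 1 2 by simp
qed

section \<open>Orthogonal projection onto a span\<close>

lemma ortho_proj_span:
  fixes W :: "(real^'n) set"
  shows "ortho_proj (span W) x \<in> span W"
    and "\<And>w. w \<in> span W \<Longrightarrow> (x - ortho_proj (span W) x) \<bullet> w = 0"
proof -
  obtain y z where yz: "y \<in> span W" "\<And>w. w \<in> span W \<Longrightarrow> orthogonal z w" "x = y + z"
    using orthogonal_subspace_decomp_exists by blast
  have y: "y \<in> span W \<and> (\<forall>w\<in>span W. (x - y) \<bullet> w = 0)"
    using yz by (auto simp: orthogonal_def)
  have "ortho_proj (span W) x = y"
    unfolding ortho_proj_def
  proof (rule the_equality[where P = "\<lambda>p. p \<in> span W \<and> (\<forall>w\<in>span W. (x - p) \<bullet> w = 0)", OF y])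
    fix p assume p: "p \<in> span W \<and> (\<forall>w\<in>span W. (x - p) \<bullet> w = 0)"
    then have "p - y \<in> span W" using yz(1) by (auto intro: span_diff)
    then have "(x - y) \<bullet> (p - y) = 0" "(x - p) \<bullet> (p - y) = 0" using p y by auto
    then have "(p - y) \<bullet> (p - y) = 0" by (simp add: algebra_simps)
    then show "p = y" by simp
  qed
  then show "ortho_proj (span W) x \<in> span W"
    "\<And>w. w \<in> span W \<Longrightarrow> (x - ortho_proj (span W) x) \<bullet> w = 0"
    using y by auto
qed

text \<open>The members of \<open>normal_basis v f\<close>, indexed by vertices off \<open>f\<close> instead of positions.\<close>

section \<open>Barycentric coordinates\<close>

locale nondegenerate_simplex =
  fixes v :: "nat \<Rightarrow> real^'n"
  assumes inj_vertices: "inj_on v {0..CARD('n)}"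
    and independent_vertices: "\<not> affine_dependent (v ` {0..CARD('n)})"
begin

lemma affine_coordinates_unique:
  assumes "(\<Sum>j\<le>CARD('n). c j) = (\<Sum>j\<le>CARD('n). c' j)"
    and "(\<Sum>j\<le>CARD('n). c j *\<^sub>R v j) = (\<Sum>j\<le>CARD('n). c' j *\<^sub>R v j)"
    and "i \<le> CARD('n)"
  shows "c i = c' i"
proof (rule ccontr)
  assume ne: "c i \<noteq> c' i"
  let ?V = "v ` {0..CARD('n)}"
  define U where "U y = (let j = the_inv_into {0..CARD('n)} v y in c j - c' j)" for y
  have U: "U (v j) = c j - c' j" if "j \<le> CARD('n)" for j
    using that the_inv_into_f_f[OF inj_vertices] by (simp add: U_def)
  have "sum U ?V = (\<Sum>j\<le>CARD('n). c j - c' j)"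
    unfolding sum.reindex[OF inj_vertices] by (intro sum.cong) (auto simp: U)
  moreover have "(\<Sum>y\<in>?V. U y *\<^sub>R y) = (\<Sum>j\<le>CARD('n). (c j - c' j) *\<^sub>R v j)"
    unfolding sum.reindex[OF inj_vertices] by (intro sum.cong) (auto simp: U)
  moreover have "U (v i) \<noteq> 0" "v i \<in> ?V" using U assms(3) ne by auto
  ultimately have "affine_dependent ?V"
    using assms(1,2)
    by (subst affine_dependent_explicit_finite)
      (auto simp: sum_subtractf scaleR_left_diff_distrib intro!: exI[of _ U])
  then show False using independent_vertices by contradiction
qed

lemma affine_coordinates_exist:
  obtains c where "\<And>j. j > CARD('n) \<Longrightarrow> c j = 0" "(\<Sum>j\<le>CARD('n). c j) = 1"
    "(\<Sum>j\<le>CARD('n). c j *\<^sub>R v j) = x"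
proof -
  let ?V = "v ` {0..CARD('n)}"
  have "affine hull ?V = UNIV"
    using independent_vertices by (rule affine_independent_span_eq) (simp add: card_image[OF inj_vertices])
  then obtain u where u: "sum u ?V = 1" "(\<Sum>y\<in>?V. u y *\<^sub>R y) = x"
    using affine_hull_finite[of ?V] by auto
  show thesis
  proof (rule that[of "\<lambda>j. if j \<le> CARD('n) then u (v j) else 0"])
    show "(\<Sum>j\<le>CARD('n). if j \<le> CARD('n) then u (v j) else 0) = 1"
      using u(1) unfolding sum.reindex[OF inj_vertices] by (simp add: atMost_atLeast0)
    show "(\<Sum>j\<le>CARD('n). (if j \<le> CARD('n) then u (v j) else 0) *\<^sub>R v j) = x"
      using u(2) unfolding sum.reindex[OF inj_vertices] by (simp add: atMost_atLeast0)
  qed simp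
qed

lemma bary_eqI:
  assumes "(\<Sum>j\<le>CARD('n). c j) = 1" "(\<Sum>j\<le>CARD('n). c j *\<^sub>R v j) = x" "i \<le> CARD('n)"
  shows "bary v i x = c i"
proof -
  define c' where "c' j = (if j \<le> CARD('n) then c j else 0)" for j
  have c': "(\<Sum>j\<le>CARD('n). c' j) = 1" "(\<Sum>j\<le>CARD('n). c' j *\<^sub>R v j) = x" "\<forall>j>CARD('n). c' j = 0"
    using assms by (auto simp: c'_def)
  have "(THE c. (\<forall>j>CARD('n). c j = 0) \<and> (\<Sum>j\<le>CARD('n). c j) = 1
      \<and> (\<Sum>j\<le>CARD('n). c j *\<^sub>R v j) = x) = c'"
  proof (rule the_equality)
    fix b assume b: "(\<forall>j>CARD('n). b j = 0) \<and> (\<Sum>j\<le>CARD('n). b j) = 1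
      \<and> (\<Sum>j\<le>CARD('n). b j *\<^sub>R v j) = x"
    show "b = c'"
    proof
      fix j
      show "b j = c' j"
        using b c' affine_coordinates_unique[of b c' j] by (cases "j \<le> CARD('n)") auto
    qed
  qed (use c' in blast)
  then show ?thesis using assms(3) by (simp add: bary_def c'_def)
qed

lemma bary_sum: "(\<Sum>j\<le>CARD('n). bary v j x) = 1" (is ?sum)
  and bary_combination: "(\<Sum>j\<le>CARD('n). bary v j x *\<^sub>R v j) = x" (is ?comb)
proof -
  obtain c where c: "(\<Sum>j\<le>CARD('n). c j) = 1" "(\<Sum>j\<le>CARD('n). c j *\<^sub>R v j) = x"
    using affine_coordinates_exist by blast
  then have "\<forall>j\<le>CARD('n). bary v j x = c j" using bary_eqI by blast
  then show ?sum ?comb using c by simp_all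
qed

lemma bary_vertex:
  assumes "i \<le> CARD('n)" "j \<le> CARD('n)"
  shows "bary v i (v j) = (if i = j then 1 else 0)"
proof -
  have "bary v i (v j) = (\<lambda>l. if l = j then 1 else 0) i"
    using assms by (intro bary_eqI) (auto simp: if_distrib[of "\<lambda>t. t *\<^sub>R _"] cong: if_cong)
  then show ?thesis by simp
qed

lemma bary_affine:
  assumes i: "i \<le> CARD('n)"
  obtains g where "\<And>x. bary v i x = bary v i 0 + x \<bullet> g"
proof -
  define h where "h x = bary v i x - bary v i 0" for x
  have "linear h"
  proof (rule linearI)
    fix x y
    have "bary v i (x + y) = (\<lambda>j. bary v j x + bary v j y - bary v j 0) i"
      using bary_sum bary_combination i
      by (intro bary_eqI) (simp_all add: sum.distrib sum_subtractf scaleR_add_left scaleR_diff_left)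
    then show "h (x + y) = h x + h y" by (simp add: h_def)
  next
    fix t x
    have "bary v i (t *\<^sub>R x) = (\<lambda>j. t * bary v j x + (1 - t) * bary v j 0) i"
    proof (rule bary_eqI[OF _ _ i])
      show "(\<Sum>j\<le>CARD('n). t * bary v j x + (1 - t) * bary v j 0) = 1"
        by (simp only: sum.distrib sum_distrib_left[symmetric] bary_sum) simp
      show "(\<Sum>j\<le>CARD('n). (t * bary v j x + (1 - t) * bary v j 0) *\<^sub>R v j) = t *\<^sub>R x"
        by (simp only: sum.distrib scaleR_add_left scaleR_scaleR[symmetric]
            scaleR_sum_right[symmetric] bary_combination) simp
    qed
    then show "h (t *\<^sub>R x) = t *\<^sub>R h x" by (simp add: h_def algebra_simps)
  qed
  then have rep: "h x = x \<bullet> adjoint h 1" for x by (simp add: adjoint_works)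
  have "bary v i x = bary v i 0 + x \<bullet> adjoint h 1" for x
    unfolding rep[symmetric] h_def by simp
  then show thesis by (rule that)
qed

lemma bary_gradient:
  assumes "i \<le> CARD('n)"
  shows "gradient (bary v i) x = gradient (bary v i) 0"
    and "bary v i x = bary v i 0 + x \<bullet> gradient (bary v i) 0"
    and "real_polynomial_function (bary v i)"
proof -
  obtain g where g: "\<And>x. bary v i x = bary v i 0 + x \<bullet> g" using bary_affine[OF assms] by blast
  then have eq: "bary v i = (\<lambda>x. bary v i 0 + x \<bullet> g)" by blast
  have "GDERIV (\<lambda>x. bary v i 0 + x \<bullet> g) y :> g" for y
    unfolding gderiv_def by (auto intro!: derivative_eq_intros)
  then have grad: "gradient (bary v i) y = g" for y using gradient_eq eq by metis
  then show "gradient (bary v i) x = gradient (bary v i) 0"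
    by (simp only:)
  show "bary v i x = bary v i 0 + x \<bullet> gradient (bary v i) 0"
    unfolding grad by (rule g)
  have "real_polynomial_function (\<lambda>x. bary v i 0 + x \<bullet> g)"
    by (intro real_polynomial_function.intros(1-3) bounded_linear_inner_left)
  then show "real_polynomial_function (bary v i)" by (subst eq)
qed

lemma face_point:
  assumes f: "f \<subseteq> {0..CARD('n)}" and t: "\<And>i. i \<in> f \<Longrightarrow> t i \<ge> 0" "(\<Sum>i\<in>f. t i) = 1"
    and x: "x = (\<Sum>i\<in>f. t i *\<^sub>R v i)"
  shows "x \<in> subsimplex v f"
    and "\<And>i. i \<in> f \<Longrightarrow> bary v i x = t i"
    and "\<And>i. i \<in> opposite CARD('n) f \<Longrightarrow> bary v i x = 0"
proof -
  have fin: "finite f" using f by (rule finite_subset) simp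
  show "x \<in> subsimplex v f"
    unfolding subsimplex_def x
    by (rule convex_sum[OF fin convex_convex_hull t(2)]) (auto simp: t(1) intro: hull_inc)
  have "(\<Sum>j\<le>CARD('n). if j \<in> f then t j else 0) = 1"
    "(\<Sum>j\<le>CARD('n). (if j \<in> f then t j else 0) *\<^sub>R v j) = x"
    unfolding sum_split_opposite[OF f] using t(2) x by (simp_all add: opposite_def)
  then have "bary v i x = (if i \<in> f then t i else 0)" if "i \<le> CARD('n)" for i
    using bary_eqI[of "\<lambda>j. if j \<in> f then t j else 0"] that by simp
  then show "\<And>i. i \<in> f \<Longrightarrow> bary v i x = t i" "\<And>i. i \<in> opposite CARD('n) f \<Longrightarrow> bary v i x = 0"
    using f by (auto simp: opposite_def)
qed

lemma bary_on_face:
  assumes f: "f \<subseteq> {0..CARD('n)}" and x: "x \<in> subsimplex v f" and i: "i \<in> opposite CARD('n) f"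
  shows "bary v i x = 0"
proof -
  have inj: "inj_on v f" using inj_vertices f by (rule inj_on_subset)
  have fin: "finite f" using f by (rule finite_subset) simp
  obtain u where "\<forall>y\<in>v ` f. 0 \<le> u y" "sum u (v ` f) = 1" "(\<Sum>y\<in>v ` f. u y *\<^sub>R y) = x"
    using x fin unfolding subsimplex_def by (auto simp: convex_hull_finite)
  then have "\<And>j. j \<in> f \<Longrightarrow> 0 \<le> u (v j)" "(\<Sum>j\<in>f. u (v j)) = 1" "x = (\<Sum>j\<in>f. u (v j) *\<^sub>R v j)"
    by (auto simp: sum.reindex[OF inj])
  from face_point(3)[OF f this i] show ?thesis .
qed

section \<open>The tangential-normal basis\<close>

definition normal_vector :: "nat set \<Rightarrow> nat \<Rightarrow> real^'n" where
  "normal_vector f i = proj_grad v f i /\<^sub>R (norm (proj_grad v f i))\<^sup>2"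

text \<open>For \<open>j \<noteq> i\<close> off \<open>f\<close>, the coordinate \<open>\<lambda>\<^sub>j\<close> vanishes on \<open>f \<union> {i}\<close>, hence its gradient is orthogonal
  to every tangent vector of \<open>f \<union> {i}\<close>.  The gradient of \<open>\<lambda>\<^sub>i\<close> and its projection \<open>p\<close> have the
  same inner product \<open>|p|\<^sup>2\<close> with \<open>p\<close>, which the rescaling turns into \<open>1\<close>; and \<open>p\<close> is nonzero
  because \<open>\<lambda>\<^sub>i\<close> varies along the edges that join \<open>f\<close> to the vertex \<open>i\<close>.\<close>

lemma normal_vector_dual:
  assumes f: "f \<subseteq> {0..CARD('n)}" "f \<noteq> {}"
    and i: "i \<in> opposite CARD('n) f" and j: "j \<in> opposite CARD('n) f"
  shows "gradient (bary v j) 0 \<bullet> normal_vector f i = (if i = j then 1 else 0)"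
proof -
  define W where "W = {v a - v b | a b. a \<in> f \<union> {i} \<and> b \<in> f \<union> {i}}"
  let ?p = "proj_grad v f i" and ?g = "\<lambda>j. gradient (bary v j) 0"
  have p_def: "?p = ortho_proj (span W) (?g i)"
    by (simp add: proj_grad_def tangent_space_def W_def)
  have p: "?p \<in> span W" "\<And>w. w \<in> span W \<Longrightarrow> ?g i \<bullet> w = ?p \<bullet> w"
    using ortho_proj_span[where W = W and x = "?g i"] unfolding p_def by (auto simp: inner_diff_left)
  have le: "a \<le> CARD('n)" if "a \<in> f \<union> {i}" for a
    using that f(1) i by (auto simp: opposite_def)
  have jle: "j \<le> CARD('n)" using j by (simp add: opposite_def)
  have edge: "?g l \<bullet> (v a - v b) = (if l = a then 1 else 0) - (if l = b then 1 else 0)"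
    if "l \<le> CARD('n)" "a \<in> f \<union> {i}" "b \<in> f \<union> {i}" for l a b
  proof -
    have "?g l \<bullet> (v a - v b) = bary v l (v a) - bary v l (v b)"
      using bary_gradient(2)[OF that(1), of "v a"] bary_gradient(2)[OF that(1), of "v b"]
      by (simp add: inner_diff_right inner_commute)
    then show ?thesis using that le by (simp add: bary_vertex)
  qed
  show ?thesis
  proof (cases "i = j")
    case False
    have "\<forall>w\<in>W. ?g j \<bullet> w = 0"
      using edge[OF jle] j False by (auto simp: W_def opposite_def)
    then have "\<forall>w\<in>span W. ?g j \<bullet> w = 0"
      using span_induct[of _ W "\<lambda>w. ?g j \<bullet> w = 0"] subspace_hyperplane[of "?g j"] by auto
    then show ?thesis using p(1) False by (simp add: normal_vector_def)
  next
    case True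
    obtain a where a: "a \<in> f" using f(2) by blast
    then have "?g i \<bullet> (v i - v a) = 1"
      using edge[of i i a] le[of i] i by (auto simp: opposite_def)
    moreover have "v i - v a \<in> span W" using a by (intro span_base) (auto simp: W_def)
    ultimately have "?p \<noteq> 0" using p(2) by force
    moreover have "?g i \<bullet> ?p = (norm ?p)\<^sup>2" using p by (simp add: power2_norm_eq_inner)
    ultimately show ?thesis using True by (simp add: normal_vector_def)
  qed
qed

lemma dir_deriv_normal_bary:
  assumes "f \<subseteq> {0..CARD('n)}" "f \<noteq> {}" "i \<in> opposite CARD('n) f" "j \<in> opposite CARD('n) f"
  shows "dir_deriv (normal_vector f i) (bary v j) = (\<lambda>x. if i = j then 1 else 0)"
proof -
  have j: "j \<le> CARD('n)" using assms(4) by (simp add: opposite_def)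
  have "gradient (bary v j) x \<bullet> normal_vector f i = (if i = j then 1 else 0)" for x
    using normal_vector_dual[OF assms] bary_gradient(1)[OF j, of x] by simp
  then show ?thesis by (simp add: dir_deriv_def)
qed

end

section \<open>The Bernstein basis of a sub-simplex\<close>

lemma prod_power_raise:
  fixes t :: "'a \<Rightarrow> real"
  assumes "finite I" "i \<in> I"
  shows "t i * (\<Prod>l\<in>I. t l ^ a l) = (\<Prod>l\<in>I. t l ^ (a(i := Suc (a i))) l)"
  using assms by (simp add: prod.remove)

lemma lattice_raise:
  assumes "\<nu> \<in> lattice n j" "i \<le> n"
  shows "\<nu>(i := Suc (\<nu> i)) \<in> lattice n (Suc j)"
  using assms by (auto simp: lattice_def sum.remove[of "{..n}" i])

lemma lattice_lower:
  assumes "\<nu> \<in> lattice n (Suc j)"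
  obtains i \<nu>' where "i \<le> n" "\<nu>' \<in> lattice n j" "\<nu> = \<nu>'(i := Suc (\<nu>' i))"
proof -
  have "(\<Sum>i\<le>n. \<nu> i) \<noteq> 0" using assms by (simp add: lattice_def)
  then obtain i where i: "i \<le> n" "\<nu> i \<noteq> 0" by (metis atMost_iff sum.neutral)
  have "\<nu>(i := \<nu> i - 1) \<in> lattice n j"
    using assms i by (auto simp: lattice_def sum.remove[of "{..n}" i])
  then show thesis using i by (intro that[of i "\<nu>(i := \<nu> i - 1)"]) auto
qed

lemma polys_eq_lincomb:
  "polys j = lincomb {a. (\<Sum>i\<in>UNIV. a i) \<le> j} (\<lambda>a x. \<Prod>i\<in>UNIV. (x $ i) ^ a i)"
  by (simp add: polys_def lincomb_def)

lemma finite_exponents: "finite {a :: 'n::finite \<Rightarrow> nat. (\<Sum>i\<in>UNIV. a i) \<le> j}"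
proof (rule finite_subset)
  show "{a :: 'n \<Rightarrow> nat. (\<Sum>i\<in>UNIV. a i) \<le> j} \<subseteq> UNIV \<rightarrow>\<^sub>E {..j}"
  proof
    fix a :: "'n \<Rightarrow> nat" assume "a \<in> {a. (\<Sum>i\<in>UNIV. a i) \<le> j}"
    then have "a i \<le> j" for i using member_le_sum[of i UNIV a] by auto
    then show "a \<in> UNIV \<rightarrow>\<^sub>E {..j}" by auto
  qed
  show "finite ((UNIV :: 'n set) \<rightarrow>\<^sub>E {..j})" by (intro finite_PiE) auto
qed

lemma polys_affine_mult:
  fixes g :: "real^'n"
  assumes "p \<in> polys j"
  shows "(\<lambda>x. (t + x \<bullet> g) * p x) \<in> polys (Suc j)"
  using finite_exponents assms unfolding polys_eq_lincomb
proof (rule lincomb_mult)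
  fix a :: "'n \<Rightarrow> nat" assume a: "a \<in> {a. (\<Sum>i\<in>UNIV. a i) \<le> j}"
  let ?M = "\<lambda>a x. \<Prod>i\<in>UNIV. ((x :: real^'n) $ i) ^ a i"
  let ?I = "{a :: 'n \<Rightarrow> nat. (\<Sum>i\<in>UNIV. a i) \<le> Suc j}"
  have "a(i := Suc (a i)) \<in> ?I" for i
    using a by (simp add: sum.remove[of UNIV i])
  then have "?M (a(i := Suc (a i))) \<in> lincomb ?I ?M" for i
    by (rule lincomb_base[OF finite_exponents])
  moreover have "?M a \<in> lincomb ?I ?M"
    using a by (intro lincomb_base finite_exponents) auto
  ultimately have "(\<lambda>x. t * ?M a x + (\<Sum>i\<in>UNIV. g $ i * ?M (a(i := Suc (a i))) x)) \<in> lincomb ?I ?M"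
    by (intro lincomb_add lincomb_scale lincomb_sum) auto
  moreover have "(t + x \<bullet> g) * ?M a x = t * ?M a x + (\<Sum>i\<in>UNIV. g $ i * ?M (a(i := Suc (a i))) x)" for x
  proof -
    have "(x \<bullet> g) * ?M a x = (\<Sum>i\<in>UNIV. g $ i * (x $ i * ?M a x))"
      unfolding inner_vec_def sum_distrib_right by (intro sum.cong) (simp_all add: mult_ac)
    also have "\<dots> = (\<Sum>i\<in>UNIV. g $ i * ?M (a(i := Suc (a i))) x)"
      by (intro sum.cong refl arg_cong2[where f = "(*)"] prod_power_raise) auto
    finally show ?thesis by (simp add: distrib_right)
  qed
  ultimately show "(\<lambda>x. (t + x \<bullet> g) * ?M a x) \<in> lincomb ?I ?M" by simp
qed

lemma restr_lincomb:
  "restr S ` lincomb I M = lincomb I (\<lambda>a. restr S (M a))"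
proof -
  have "restr S (\<lambda>x. \<Sum>a\<in>I. c a * M a x) = (\<lambda>x. \<Sum>a\<in>I. c a * restr S (M a) x)" for c
    by (auto simp: restr_def)
  then show ?thesis unfolding lincomb_def by (auto simp: image_iff) metis
qed

context nondegenerate_simplex
begin

definition face_monomial :: "nat set \<Rightarrow> (nat \<Rightarrow> nat) \<Rightarrow> real^'n \<Rightarrow> real" where
  "face_monomial f \<nu> = restr (subsimplex v f)
     (\<lambda>x. \<Prod>i<card f. bary v (sorted_list_of_set f ! i) x ^ \<nu> i)"

context
  fixes f :: "nat set" and n :: nat
  assumes f: "f \<subseteq> {0..CARD('n)}" and card_f: "card f = Suc n"
begin

lemma finite_face: "finite f"
  using f by (rule finite_subset) simp

lemma nth_face: "i \<le> n \<Longrightarrow> sorted_list_of_set f ! i \<in> f"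
  using nth_mem[of i "sorted_list_of_set f"] finite_face card_f by simp

lemma face_monomial_eq:
  "x \<in> subsimplex v f \<Longrightarrow>
    face_monomial f \<nu> x = (\<Prod>i\<le>n. bary v (sorted_list_of_set f ! i) x ^ \<nu> i)"
  by (simp add: face_monomial_def restr_def card_f lessThan_Suc_atMost)

lemma face_monomial_polys:
  assumes "\<nu> \<in> lattice n j"
  shows "(\<lambda>x. \<Prod>i\<le>n. bary v (sorted_list_of_set f ! i) x ^ \<nu> i) \<in> polys j"
  using assms
proof (induction j arbitrary: \<nu>)
  case 0
  then have "(\<lambda>x. \<Prod>i\<le>n. bary v (sorted_list_of_set f ! i) x ^ \<nu> i)
      = (\<lambda>x::real^'n. \<Prod>i\<in>UNIV. (x $ i) ^ (\<lambda>_. 0) i)"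
    by (simp add: lattice_def)
  also have "\<dots> \<in> polys 0"
    unfolding polys_eq_lincomb by (rule lincomb_base[OF finite_exponents]) simp
  finally show ?case .
next
  case (Suc j)
  from Suc.prems obtain i \<nu>' where i: "i \<le> n" "\<nu>' \<in> lattice n j" "\<nu> = \<nu>'(i := Suc (\<nu>' i))"
    by (rule lattice_lower)
  let ?b = "\<lambda>i. bary v (sorted_list_of_set f ! i)"
  have "sorted_list_of_set f ! i \<le> CARD('n)" using nth_face[OF i(1)] f by auto
  from bary_affine[OF this] obtain g where g: "\<And>x. ?b i x = ?b i 0 + x \<bullet> g" by blast
  have "(\<Prod>l\<le>n. ?b l x ^ \<nu> l) = (?b i 0 + x \<bullet> g) * (\<Prod>l\<le>n. ?b l x ^ \<nu>' l)" for x
    unfolding i(3) g[symmetric]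
    by (rule prod_power_raise[symmetric]) (use i(1) in auto)
  then show ?case using polys_affine_mult[OF Suc.IH[OF i(2)], of "?b i 0" g] by simp
qed

text \<open>On \<open>f\<close> the constant \<open>1\<close> and the Cartesian coordinates are linear forms in the barycentric
  coordinates of \<open>f\<close>.  Multiplying by \<open>1 = \<Sum>i. \<lambda>\<^sub>i\<close> lets a polynomial of low degree be written
  homogeneously of degree \<open>j\<close>.\<close>

lemma face_linear_form_mult:
  assumes h: "\<And>x. x \<in> subsimplex v f \<Longrightarrow> h x = (\<Sum>i\<le>n. c i * bary v (sorted_list_of_set f ! i) x)"
    and q: "q \<in> lincomb (lattice n j) (face_monomial f)"
  shows "(\<lambda>x. h x * q x) \<in> lincomb (lattice n (Suc j)) (face_monomial f)"
  using finite_lattice q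
proof (rule lincomb_mult)
  fix a assume a: "a \<in> lattice n j"
  have "(\<lambda>x. \<Sum>i\<le>n. c i * face_monomial f (a(i := Suc (a i))) x)
      \<in> lincomb (lattice n (Suc j)) (face_monomial f)"
    by (intro lincomb_sum lincomb_scale lincomb_base finite_lattice finite_atMost
        lattice_raise[OF a]) simp
  moreover have "h x * face_monomial f a x
      = (\<Sum>i\<le>n. c i * face_monomial f (a(i := Suc (a i))) x)" for x
  proof (cases "x \<in> subsimplex v f")
    case True
    let ?b = "\<lambda>i. bary v (sorted_list_of_set f ! i)"
    have "h x * face_monomial f a x = (\<Sum>i\<le>n. c i * (?b i x * (\<Prod>l\<le>n. ?b l x ^ a l)))"
      by (simp add: h True face_monomial_eq sum_distrib_right mult.assoc)
    also have "\<dots> = (\<Sum>i\<le>n. c i * face_monomial f (a(i := Suc (a i))) x)"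
      unfolding face_monomial_eq[OF True]
      by (intro sum.cong refl arg_cong2[where f = "(*)"] prod_power_raise) auto
    finally show ?thesis .
  qed (simp add: face_monomial_def restr_def)
  ultimately show "(\<lambda>x. h x * face_monomial f a x)
      \<in> lincomb (lattice n (Suc j)) (face_monomial f)" by simp
qed

lemma face_sum_bary:
  assumes "x \<in> subsimplex v f"
  shows "(\<Sum>i\<le>n. bary v (sorted_list_of_set f ! i) x) = 1"
    and "(\<Sum>i\<le>n. bary v (sorted_list_of_set f ! i) x *\<^sub>R v (sorted_list_of_set f ! i)) = x"
proof -
  have off: "bary v i x = 0" if "i \<in> opposite CARD('n) f" for i
    using bary_on_face[OF f assms that] .
  have bij: "bij_betw (\<lambda>i. sorted_list_of_set f ! i) {..n} f"
    using bij_betw_sorted_list_of_set[OF finite_face] by (simp add: card_f lessThan_Suc_atMost)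
  show "(\<Sum>i\<le>n. bary v (sorted_list_of_set f ! i) x) = 1"
    using sum.reindex_bij_betw[OF bij, of "\<lambda>i. bary v i x"] bary_sum[of x]
    unfolding sum_split_opposite[OF f] by (simp add: off)
  show "(\<Sum>i\<le>n. bary v (sorted_list_of_set f ! i) x *\<^sub>R v (sorted_list_of_set f ! i)) = x"
    using sum.reindex_bij_betw[OF bij, of "\<lambda>i. bary v i x *\<^sub>R v i"] bary_combination[of x]
    unfolding sum_split_opposite[OF f] by (simp add: off)
qed

lemma monomial_on_face:
  fixes a :: "'n \<Rightarrow> nat"
  assumes "(\<Sum>i\<in>UNIV. a i) \<le> j"
  shows "restr (subsimplex v f) (\<lambda>x. \<Prod>i\<in>UNIV. (x $ i) ^ a i) \<in> lincomb (lattice n j) (face_monomial f)"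
  using assms
proof (induction j arbitrary: a)
  case 0
  have "restr (subsimplex v f) (\<lambda>x. \<Prod>i\<in>UNIV. (x $ i) ^ a i) = face_monomial f (\<lambda>_. 0)"
    using 0 by (simp add: face_monomial_def)
  moreover have "(\<lambda>_. 0) \<in> lattice n 0" by (simp add: lattice_def)
  ultimately show ?case by (simp add: lincomb_base finite_lattice)
next
  case (Suc j)
  let ?R = "\<lambda>a. restr (subsimplex v f) (\<lambda>x. \<Prod>i\<in>UNIV. (x $ i) ^ (a :: 'n \<Rightarrow> nat) i)"
  show ?case
  proof (cases "\<forall>i. a i = 0")
    case True
    then have "?R a \<in> lincomb (lattice n j) (face_monomial f)" by (intro Suc.IH) simp
    then have "(\<lambda>x. 1 * ?R a x) \<in> lincomb (lattice n (Suc j)) (face_monomial f)"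
      by (intro face_linear_form_mult[where c = "\<lambda>_. 1"]) (simp_all add: face_sum_bary)
    then show ?thesis by simp
  next
    case False
    then obtain i where i: "a i \<noteq> 0" by blast
    define a' where "a' = a(i := a i - 1)"
    have a: "a = a'(i := Suc (a' i))" using i by (auto simp: a'_def)
    have "(\<Sum>l\<in>UNIV. a' l) \<le> j"
      using Suc.prems i by (simp add: a'_def sum.remove[of UNIV i])
    then have "?R a' \<in> lincomb (lattice n j) (face_monomial f)" by (rule Suc.IH)
    then have "(\<lambda>x. x $ i * ?R a' x) \<in> lincomb (lattice n (Suc j)) (face_monomial f)"
    proof (rule face_linear_form_mult[rotated])
      fix x assume "x \<in> subsimplex v f"
      from arg_cong[OF face_sum_bary(2)[OF this], of "\<lambda>y. y $ i"]
      show "x $ i = (\<Sum>l\<le>n. v (sorted_list_of_set f ! l) $ i * bary v (sorted_list_of_set f ! l) x)"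
        by (simp add: mult.commute)
    qed
    moreover have "?R a = (\<lambda>x. x $ i * ?R a' x)"
    proof
      fix x :: "real^'n"
      have "x $ i * (\<Prod>l\<in>UNIV. (x $ l) ^ a' l) = (\<Prod>l\<in>UNIV. (x $ l) ^ a l)"
        unfolding a by (rule prod_power_raise) simp_all
      then show "?R a x = x $ i * ?R a' x" by (simp add: restr_def)
    qed
    ultimately show ?thesis by simp
  qed
qed

lemma bernstein_on_eq:
  "bernstein_on v f j = (\<lambda>\<nu> x. (fact j / (\<Prod>i<card f. fact (\<nu> i))) * face_monomial f \<nu> x)"
  by (auto simp: bernstein_on_def face_monomial_def restr_def fun_eq_iff)

text \<open>Both inclusions matter for the dual functionals: that the Bernstein polynomials span makes a
  functional with prescribed values on them unique, and functionals are linear only on polynomials,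
  so the Bernstein polynomials have to be of that kind.\<close>

lemma polys_on_eq_bernstein:
  "polys_on v f j = lincomb (lattice n j) (bernstein_on v f j)"
proof -
  have "polys_on v f j = lincomb (lattice n j) (face_monomial f)"
  proof
    show "polys_on v f j \<subseteq> lincomb (lattice n j) (face_monomial f)"
      unfolding polys_on_def polys_eq_lincomb restr_lincomb
      by (rule lincomb_mono[OF finite_exponents]) (simp add: monomial_on_face)
    have "lincomb (lattice n j) (face_monomial f)
        = restr (subsimplex v f) ` lincomb (lattice n j)
            (\<lambda>\<nu> x. \<Prod>i\<le>n. bary v (sorted_list_of_set f ! i) x ^ \<nu> i)"
      unfolding restr_lincomb
      by (intro arg_cong[where f = "lincomb (lattice n j)"])
        (simp add: fun_eq_iff face_monomial_def card_f lessThan_Suc_atMost)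
    also have "\<dots> \<subseteq> polys_on v f j"
      unfolding polys_on_def
    proof (intro image_mono)
      show "lincomb (lattice n j) (\<lambda>\<nu> x. \<Prod>i\<le>n. bary v (sorted_list_of_set f ! i) x ^ \<nu> i) \<subseteq> polys j"
        unfolding polys_eq_lincomb
        by (rule lincomb_mono[OF finite_lattice]) (rule face_monomial_polys[unfolded polys_eq_lincomb])
    qed
    finally show "lincomb (lattice n j) (face_monomial f) \<subseteq> polys_on v f j" .
  qed
  also have "\<dots> = lincomb (lattice n j) (bernstein_on v f j)"
    unfolding bernstein_on_eq
    by (rule lincomb_rescale[OF finite_lattice, symmetric]) simp
  finally show ?thesis .
qed

text \<open>The barycentric coordinates of the points of \<open>f\<close> are all nonnegative tuples of sum \<open>1\<close>;
  homogeneity extends the vanishing from these to all positive tuples.\<close>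

lemma bernstein_on_independent:
  assumes "\<And>x. (\<Sum>\<nu>\<in>lattice n j. c \<nu> * bernstein_on v f j \<nu> x) = 0"
  shows "\<forall>\<nu>\<in>lattice n j. c \<nu> = 0"
proof
  fix \<mu> assume \<mu>: "\<mu> \<in> lattice n j"
  define C where "C \<nu> = c \<nu> * (fact j / (\<Prod>i<card f. fact (\<nu> i)))" for \<nu>
  let ?F = "\<lambda>i. sorted_list_of_set f ! i"
  have "C \<mu> = 0"
  proof (rule homogeneous_independent[OF _ \<mu>])
    fix t :: "nat \<Rightarrow> real" assume t: "\<And>i. t i > 0"
    define T where "T = (\<Sum>i\<le>n. t i)"
    have T: "T > 0" unfolding T_def using t by (intro sum_pos) auto
    have bij: "bij_betw ?F {..n} f"
      using bij_betw_sorted_list_of_set[OF finite_face] by (simp add: card_f lessThan_Suc_atMost)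
    define s where "s l = t (the_inv_into {..n} ?F l) / T" for l
    have s: "s (?F i) = t i / T" if "i \<le> n" for i
      using the_inv_into_f_f[OF bij_betw_imp_inj_on[OF bij]] that by (simp add: s_def)
    define x where "x = (\<Sum>l\<in>f. s l *\<^sub>R v l)"
    have s1: "(\<Sum>l\<in>f. s l) = 1"
    proof -
      have "(\<Sum>l\<in>f. s l) = (\<Sum>i\<le>n. t i / T)"
        using sum.reindex_bij_betw[OF bij, of s, symmetric] by (simp add: s)
      then show ?thesis using T by (simp add: sum_divide_distrib[symmetric] T_def)
    qed
    have s0: "s l \<ge> 0" for l using t T by (simp add: s_def less_imp_le)
    note pt = face_point[OF f s0 s1 x_def]
    have bt: "bary v (?F i) x = t i / T" if "i \<le> n" for i
      using pt(2)[OF nth_face[OF that]] s[OF that] by simp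
    have hom: "face_monomial f \<nu> x = (\<Prod>i\<le>n. t i ^ \<nu> i) / T ^ j" if "\<nu> \<in> lattice n j" for \<nu>
    proof -
      have "face_monomial f \<nu> x = (\<Prod>i\<le>n. (t i / T) ^ \<nu> i)"
        unfolding face_monomial_eq[OF pt(1)] by (intro prod.cong) (simp_all add: bt)
      also have "\<dots> = (\<Prod>i\<le>n. t i ^ \<nu> i) / T ^ (\<Sum>i\<le>n. \<nu> i)"
        by (simp add: power_divide prod_dividef power_sum)
      finally show ?thesis using that by (simp add: lattice_def)
    qed
    have "0 = (\<Sum>\<nu>\<in>lattice n j. C \<nu> * face_monomial f \<nu> x)"
      using assms[of x] unfolding bernstein_on_eq C_def by (simp add: mult.assoc)
    also have "\<dots> = (\<Sum>\<nu>\<in>lattice n j. C \<nu> * (\<Prod>i\<le>n. t i ^ \<nu> i)) / T ^ j"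
      by (simp add: hom sum_divide_distrib)
    finally show "(\<Sum>\<nu>\<in>lattice n j. C \<nu> * (\<Prod>i\<le>n. t i ^ \<nu> i)) = 0"
      using T by simp
  qed
  then show "c \<mu> = 0" by (simp add: C_def)
qed

lemma bernstein_dual_spec:
  assumes "\<mu> \<in> lattice n j"
  shows "bernstein_dual v f j \<mu> \<in> dual_space (lincomb (lattice n j) (bernstein_on v f j))"
    and "\<And>\<nu>. \<nu> \<in> lattice n j \<Longrightarrow>
      bernstein_dual v f j \<mu> (bernstein_on v f j \<nu>) = (if \<mu> = \<nu> then 1 else 0)"
proof -
  have "\<exists>!b. b \<in> dual_space (lincomb (lattice n j) (bernstein_on v f j)) \<and>
      (\<forall>\<nu>\<in>lattice n j. b (bernstein_on v f j \<nu>) = (if \<mu> = \<nu> then 1 else 0))"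
    using finite_lattice assms bernstein_on_independent by (rule dual_basis_exists_unique)
  from theI'[OF this] show
    "bernstein_dual v f j \<mu> \<in> dual_space (lincomb (lattice n j) (bernstein_on v f j))"
    "\<And>\<nu>. \<nu> \<in> lattice n j \<Longrightarrow>
      bernstein_dual v f j \<mu> (bernstein_on v f j \<nu>) = (if \<mu> = \<nu> then 1 else 0)"
    unfolding bernstein_dual_def polys_on_eq_bernstein by (simp_all add: card_f)
qed

end

end

section \<open>The functionals on the Bernstein basis\<close>

lemma count_list_concat_replicate:
  "distinct F \<Longrightarrow> count_list (concat (map (\<lambda>j. replicate (\<alpha> j) j) F)) i = (if i \<in> set F then \<alpha> i else 0)"
proof (induction F)
  case (Cons j F)
  have "count_list (replicate m j) i = (if i = j then m else 0)" for m by (induction m) auto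
  then show ?case using Cons by auto
qed simp

context nondegenerate_simplex
begin

lemma mixed_deriv_normal_basis:
  assumes "real_polynomial_function u"
  shows "mixed_deriv u (normal_basis v f) (restr_index \<alpha> (opposite CARD('n) f)) =
    foldr dir_deriv (map (normal_vector f)
      (concat (map (\<lambda>j. replicate (\<alpha> j) j) (sorted_list_of_set (opposite CARD('n) f))))) u"
proof -
  let ?F = "sorted_list_of_set (opposite CARD('n) f)"
  have nb: "normal_basis v f = map (normal_vector f) ?F"
    by (simp add: normal_basis_def normal_vector_def)
  have "map (\<lambda>i. replicate (restr_index \<alpha> (opposite CARD('n) f) i) (map (normal_vector f) ?F ! i)) [0..<length ?F]
      = map ((\<lambda>j. replicate (\<alpha> j) (normal_vector f j)) \<circ> (\<lambda>i. ?F ! i)) [0..<length ?F]"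
    by (intro map_cong) (auto simp: restr_index_def)
  also have "\<dots> = map (\<lambda>j. replicate (\<alpha> j) (normal_vector f j)) ?F"
    unfolding map_map[symmetric] map_nth ..
  finally show ?thesis
    unfolding mixed_deriv_eq_foldr[OF assms] nb by (simp add: map_concat o_def)
qed

text \<open>The factors \<open>\<lambda>\<^sub>j\<close>, \<open>j \<notin> f\<close>, of \<open>B\<^sup>\<beta>\<close> vanish on \<open>f\<close>, and normal derivatives, no more of them than
  such factors, leave something only if they consume all of these exactly.  The derivatives then
  cancel the factorials of \<open>\<beta>\<close> off \<open>f\<close>, and the rest of \<open>B\<^sup>\<beta>\<close> differs from a Bernstein polynomial
  of \<open>f\<close> only in the normalising factorial.\<close>

lemma mixed_deriv_bernstein:
  assumes f: "f \<subseteq> {0..CARD('n)}" "f \<noteq> {}"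
    and le: "ldist CARD('n) \<alpha> f \<le> ldist CARD('n) \<beta> f"
  shows "restr (subsimplex v f)
      (mixed_deriv (bernstein v k \<beta>) (normal_basis v f) (restr_index \<alpha> (opposite CARD('n) f)))
    = (\<lambda>x. (if \<forall>j\<in>opposite CARD('n) f. \<alpha> j = \<beta> j then fact k / fact (\<Sum>i\<in>f. \<alpha> i) else 0)
        * bernstein_on v f (\<Sum>i\<in>f. \<alpha> i) (restr_index \<beta> f) x)"
    (is "restr _ ?D = ?rhs")
proof
  fix x
  let ?J = "opposite CARD('n) f"
  let ?j = "\<Sum>i\<in>f. \<alpha> i"
  define A where "A y = fact k / (\<Prod>i\<le>CARD('n). fact (\<beta> i)) * (\<Prod>i\<in>f. bary v i y ^ \<beta> i)" for y
  define js where "js = concat (map (\<lambda>j. replicate (\<alpha> j) j) (sorted_list_of_set ?J))"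
  have fin: "finite f" using f(1) by (rule finite_subset) simp
  have pol: "real_polynomial_function (bary v i)" if "i \<in> f \<union> ?J" for i
    using that f(1) by (intro bary_gradient(3)) (auto simp: opposite_def)
  have polA: "real_polynomial_function A"
    unfolding A_def using pol fin
    by (intro real_polynomial_function.intros(2,4) real_polynomial_function_prod
        real_polynomial_function_power) auto
  have B: "bernstein v k \<beta> = (\<lambda>y. A y * (\<Prod>j\<in>?J. bary v j y ^ \<beta> j))"
    by (auto simp: bernstein_def A_def prod_split_opposite[OF f(1)] mult.assoc)
  have polB: "real_polynomial_function (bernstein v k \<beta>)"
    unfolding B using polA pol
    by (intro real_polynomial_function.intros(4) real_polynomial_function_prod
        real_polynomial_function_power) auto
  show "restr (subsimplex v f) ?D x = ?rhs x"
  proof (cases "x \<in> subsimplex v f")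
    case True
    have len: "length js \<le> (\<Sum>j\<in>?J. \<beta> j)"
      using le by (simp add: js_def length_concat o_def ldist_def sum_list_distinct_conv_sum_set)
    have "?D x = foldr dir_deriv (map (normal_vector f) js) (\<lambda>y. A y * (\<Prod>j\<in>?J. bary v j y ^ \<beta> j)) x"
      unfolding mixed_deriv_normal_basis[OF polB] js_def[symmetric] by (simp only: B)
    also have "\<dots> = (if \<forall>j\<in>?J. count_list js j = \<beta> j then (\<Prod>j\<in>?J. fact (\<beta> j)) * A x else 0)"
      using pol dir_deriv_normal_bary[OF f] bary_on_face[OF f(1) True] polA len
      by (intro dual_derivatives_of_monomial) (auto simp: js_def)
    also have "\<dots> = (if \<forall>j\<in>?J. \<alpha> j = \<beta> j then (\<Prod>j\<in>?J. fact (\<beta> j)) * A x else 0)"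
      by (simp add: js_def count_list_concat_replicate)
    also have "(\<Prod>j\<in>?J. fact (\<beta> j)) * A x
        = fact k / fact ?j * (fact ?j / (\<Prod>i\<in>f. fact (\<beta> i)) * (\<Prod>i\<in>f. bary v i x ^ \<beta> i))"
      by (simp add: A_def prod_split_opposite[OF f(1)])
    also have "fact ?j / (\<Prod>i\<in>f. fact (\<beta> i)) * (\<Prod>i\<in>f. bary v i x ^ \<beta> i)
        = bernstein_on v f ?j (restr_index \<beta> f) x"
    proof -
      note reindex = prod.reindex_bij_betw[OF bij_betw_sorted_list_of_set[OF fin]]
      have "(\<Prod>i<card f. fact (restr_index \<beta> f i) :: real) = (\<Prod>i\<in>f. fact (\<beta> i))"
        using reindex[of "\<lambda>i. fact (\<beta> i) :: real"] by (simp add: restr_index_def)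
      moreover have "(\<Prod>i<card f. bary v (sorted_list_of_set f ! i) x ^ restr_index \<beta> f i)
          = (\<Prod>i\<in>f. bary v i x ^ \<beta> i)"
        using reindex[of "\<lambda>i. bary v i x ^ \<beta> i"] by (simp add: restr_index_def)
      ultimately show ?thesis using True by (simp add: bernstein_on_def restr_def)
    qed
    finally show ?thesis using True by (simp add: restr_def)
  qed (simp add: restr_def bernstein_on_def)
qed

lemma Lfun_bernstein:
  assumes f: "f \<subseteq> {0..CARD('n)}" "f \<noteq> {}"
    and \<alpha>: "\<alpha> \<in> lattice CARD('n) k" and \<beta>: "\<beta> \<in> lattice CARD('n) k"
    and le: "ldist CARD('n) \<alpha> f \<le> ldist CARD('n) \<beta> f"
  shows "Lfun v f \<alpha> (bernstein v k \<beta>)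
    = (if \<alpha> = \<beta> then fact k / fact (k - ldist CARD('n) \<alpha> f) else 0)"
proof -
  let ?J = "opposite CARD('n) f"
  define j where "j = (\<Sum>i\<in>f. \<alpha> i)"
  define n where "n = card f - 1"
  have fin: "finite f" using f(1) by (rule finite_subset) simp
  have card_f: "card f = Suc n"
    using fin f(2) by (simp add: n_def card_gt_0_iff)
  have \<alpha>f: "restr_index \<alpha> f \<in> lattice n j"
    using restr_index_lattice[OF fin f(2)] by (simp add: n_def j_def)
  note dual = bernstein_dual_spec[OF f(1) card_f \<alpha>f]
  let ?b = "bernstein_dual v f j (restr_index \<alpha> f)"
  have scale: "?b (\<lambda>x. t * p x) = t * ?b p"
    if "p \<in> lincomb (lattice n j) (bernstein_on v f j)" for t p
    using dual(1) that by (simp add: dual_space_def)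
  have L: "Lfun v f \<alpha> (bernstein v k \<beta>)
      = ?b (\<lambda>x. (if \<forall>i\<in>?J. \<alpha> i = \<beta> i then fact k / fact j else 0)
                * bernstein_on v f j (restr_index \<beta> f) x)"
    unfolding Lfun_def mixed_deriv_bernstein[OF f le] j_def ..
  show ?thesis
  proof (cases "\<forall>i\<in>?J. \<alpha> i = \<beta> i")
    case True
    have eq_iff: "\<alpha> = \<beta> \<longleftrightarrow> (\<forall>i\<in>f. \<alpha> i = \<beta> i)"
    proof
      assume "\<forall>i\<in>f. \<alpha> i = \<beta> i"
      then have "\<forall>i\<le>CARD('n). \<alpha> i = \<beta> i" using True by (auto simp: opposite_def)
      moreover have "\<forall>i>CARD('n). \<alpha> i = \<beta> i" using \<alpha> \<beta> by (simp add: lattice_def)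
      ultimately show "\<alpha> = \<beta>" by (metis ext not_le)
    qed simp
    have "ldist CARD('n) \<beta> f = ldist CARD('n) \<alpha> f" using True by (simp add: ldist_def)
    then have "(\<Sum>i\<in>f. \<beta> i) = j"
      using lattice_sum_face[OF f(1) \<alpha>] lattice_sum_face[OF f(1) \<beta>] by (simp add: j_def)
    then have \<beta>f: "restr_index \<beta> f \<in> lattice n j"
      using restr_index_lattice[OF fin f(2), of \<beta>] by (simp add: n_def)
    have "Lfun v f \<alpha> (bernstein v k \<beta>) = fact k / fact j * ?b (bernstein_on v f j (restr_index \<beta> f))"
      unfolding L using True scale[OF lincomb_base[OF finite_lattice \<beta>f], of "fact k / fact j"]
      by simp
    also have "\<dots> = (if \<alpha> = \<beta> then fact k / fact j else 0)"
      by (simp add: dual(2)[OF \<beta>f] restr_index_eq_iff[OF fin] eq_iff)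
    also have "j = k - ldist CARD('n) \<alpha> f"
      using lattice_sum_face[OF f(1) \<alpha>] by (simp add: j_def)
    finally show ?thesis .
  next
    case False
    then have "Lfun v f \<alpha> (bernstein v k \<beta>) = 0"
      unfolding L if_not_P[OF False] mult_zero_left
      using dual_space_zero[OF dual(1) lincomb_zero] by simp
    then show ?thesis using False by auto
  qed
qed

end

section \<open>The matrix\<close>

theorem theorem4p5:
  fixes v :: "nat \<Rightarrow> real^'n" and d m k :: nat and r :: "nat \<Rightarrow> nat"
  assumes dim: "CARD('n) = d" and "d \<ge> 1"
    and "r d = 0" and "r (d - 1) = m"
    and "\<And>l. l + 2 \<le> d \<Longrightarrow> r l \<ge> 2 * r (l + 1)"
    and "k \<ge> 2 * r 0 + 1"
    and nondegenerate: "inj_on v {0..d}" "\<not> affine_dependent (v ` {0..d})"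
  shows "(\<forall>ord. (\<forall>l\<le>d. linear_order_on (Delta l {0..d}) (ord l)) \<longrightarrow>
            block_lower_triangular (lattice d k) (block_indices d r) (block d k r)
              (block_order ord) (Dmat v k r))
       \<and> invertible_on (lattice d k) (Dmat v k r)
       \<and> (\<forall>l\<le>d. \<forall>f\<in>Delta l {0..d}. \<forall>s\<le>r l.
            \<forall>\<alpha>\<in>Sset d k r l f \<inter> Lset d k f s. \<forall>\<beta>\<in>Sset d k r l f \<inter> Lset d k f s.
              Dmat v k r \<alpha> \<beta> = fact k / fact (k - s) * (if \<alpha> = \<beta> then 1 else 0))"
proof -
  interpret nondegenerate_simplex v
    using nondegenerate dim by unfold_locales simp_all
  have rd: "r d = 0" and k: "2 * r 0 + 1 \<le> k"
    and dbl: "\<forall>l. l + 2 \<le> d \<longrightarrow> 2 * r (l + 1) \<le> r l"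
    using assms by auto
  have Sset_D: "\<alpha> \<in> lattice d k" "ldist d \<alpha> f \<le> r l" if "\<alpha> \<in> Sset d k r l f" for \<alpha> l f
    using that by (auto simp: Sset_def Dset_def)
  have Dmat: "Dmat v k r \<alpha> \<beta> = (if \<alpha> = \<beta> then fact k / fact (k - ldist d \<alpha> f) else 0)"
    if f: "f \<in> Delta l {0..d}" and \<alpha>: "\<alpha> \<in> Sset d k r l f" and \<beta>: "\<beta> \<in> lattice d k"
      and le: "ldist d \<alpha> f \<le> ldist d \<beta> f" for \<alpha> \<beta> l f
  proof -
    have "f \<subseteq> {0..CARD('n)}" "f \<noteq> {}" using f dim by (auto simp: Delta_def)
    then have "Lfun v f \<alpha> (bernstein v k \<beta>)
        = (if \<alpha> = \<beta> then fact k / fact (k - ldist CARD('n) \<alpha> f) else 0)"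
      using Sset_D(1)[OF \<alpha>] \<beta> le dim by (intro Lfun_bernstein) simp_all
    then show ?thesis using simplex_of_eq[OF rd dbl k f \<alpha>] dim by (simp add: Dmat_def)
  qed
  \<comment> \<open>The two reasons why the distance to \<open>f\<close> does not decrease: \<open>S(g)\<close> stays away from \<open>f\<close> when
    \<open>g\<close> is another sub-simplex of no smaller dimension, and within one \<open>S(f)\<close> it is assumed.\<close>
  have zero: "Dmat v k r \<alpha> \<beta> = 0"
    if f: "f \<in> Delta l {0..d}" "\<alpha> \<in> Sset d k r l f" and g: "g \<in> Delta l' {0..d}" "\<beta> \<in> Sset d k r l' g"
      and "l \<le> l'" and same: "f = g \<Longrightarrow> ldist d \<alpha> f \<le> ldist d \<beta> f" and "\<alpha> \<noteq> \<beta>" for \<alpha> \<beta> l l' f g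
  proof -
    have "ldist d \<alpha> f \<le> ldist d \<beta> f"
    proof (cases "f = g")
      case False
      have "r l < ldist d \<beta> f"
        using Sset_avoids_Dset[OF rd dbl k f(1) g(1) \<open>l \<le> l'\<close> False g(2)] .
      then show ?thesis using Sset_D(2)[OF f(2)] by simp
    qed (rule same)
    then show ?thesis using Dmat[OF f Sset_D(1)[OF g(2)]] \<open>\<alpha> \<noteq> \<beta>\<close> by simp
  qed
  have in_block: "(\<alpha> \<in> block d k r (l, f, s)) \<longleftrightarrow> \<alpha> \<in> Sset d k r l f \<and> ldist d \<alpha> f = s" for \<alpha> l f s
    using Sset_D(1) by (auto simp: block_def Lset_def)
  have block_inj: "b = b'"
    if b: "b \<in> block_indices d r" "\<alpha> \<in> block d k r b"
      and b': "b' \<in> block_indices d r" "\<alpha> \<in> block d k r b'" for b b' \<alpha>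
  proof -
    obtain l f s l' f' s' where eq: "b = (l, f, s)" "b' = (l', f', s')" by (metis prod_cases3)
    have f: "f \<in> Delta l {0..d}" "\<alpha> \<in> Sset d k r l f" "ldist d \<alpha> f = s"
      and f': "f' \<in> Delta l' {0..d}" "\<alpha> \<in> Sset d k r l' f'" "ldist d \<alpha> f' = s'"
      using b b' by (auto simp: eq in_block block_indices_def)
    have "f = f'" using Sset_unique[OF rd dbl k f(1,2) f'(1,2)] .
    moreover from this have "l = l'" using f(1) f'(1) by (simp add: Delta_def)
    ultimately show ?thesis using f(3) f'(3) by (simp add: eq)
  qed
  have triangular: "block_lower_triangular (lattice d k) (block_indices d r) (block d k r)
      (block_order ord) (Dmat v k r)" for ord
    unfolding block_lower_triangular_def
  proof (intro conjI ballI impI)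
    show "lattice d k = (\<Union>b\<in>block_indices d r. block d k r b)"
    proof (intro equalityI subsetI)
      fix \<alpha> assume "\<alpha> \<in> lattice d k"
      then obtain l f where lf: "l \<le> d" "f \<in> Delta l {0..d}" "\<alpha> \<in> Sset d k r l f"
        by (rule Sset_cover)
      then have "(l, f, ldist d \<alpha> f) \<in> block_indices d r" "\<alpha> \<in> block d k r (l, f, ldist d \<alpha> f)"
        using Sset_D(2) by (auto simp: block_indices_def in_block)
      then show "\<alpha> \<in> (\<Union>b\<in>block_indices d r. block d k r b)" by blast
    qed (auto simp: block_def Lset_def)
    show "disjoint_family_on (block d k r) (block_indices d r)"
      unfolding disjoint_family_on_def using block_inj by blast
    fix b b' \<alpha> \<beta>
    assume b: "b \<in> block_indices d r" "\<alpha> \<in> block d k r b"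
      and b': "b' \<in> block_indices d r" "\<beta> \<in> block d k r b'" and less: "(b, b') \<in> block_order ord"
    obtain l f s l' f' s' where eq: "b = (l, f, s)" "b' = (l', f', s')" by (metis prod_cases3)
    have "b \<noteq> b'" using less by (auto simp: eq block_order_def)
    then have "\<alpha> \<noteq> \<beta>" using block_inj b b' by blast
    have f: "f \<in> Delta l {0..d}" "\<alpha> \<in> Sset d k r l f" "ldist d \<alpha> f = s"
      and f': "f' \<in> Delta l' {0..d}" "\<beta> \<in> Sset d k r l' f'" "ldist d \<beta> f' = s'"
      using b b' by (auto simp: eq in_block block_indices_def)
    have "l \<le> l'" using less by (auto simp: eq block_order_def)
    moreover have "s < s'" if "f = f'"
    proof -
      have "l = l'" using f(1) f'(1) that by (simp add: Delta_def)
      then show ?thesis using less that by (auto simp: eq block_order_def)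
    qed
    ultimately show "Dmat v k r \<alpha> \<beta> = 0"
      using zero[OF f(1,2) f'(1,2)] \<open>\<alpha> \<noteq> \<beta>\<close> f(3) f'(3) by fastforce
  qed
  have invertible: "invertible_on (lattice d k) (Dmat v k r)"
  proof -
    let ?f = "simplex_of d k r"
    \<comment> \<open>Lexicographic in dimension and distance, since distances never exceed \<open>r 0\<close>.\<close>
    define h where "h \<alpha> = card (?f \<alpha>) * (r 0 + 1) + ldist d \<alpha> (?f \<alpha>)" for \<alpha>
    have loc: "\<exists>l. ?f \<alpha> \<in> Delta l {0..d} \<and> \<alpha> \<in> Sset d k r l (?f \<alpha>) \<and> card (?f \<alpha>) = l + 1
        \<and> ldist d \<alpha> (?f \<alpha>) \<le> r 0" if \<alpha>: "\<alpha> \<in> lattice d k" for \<alpha>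
    proof -
      obtain l f where lf: "l \<le> d" "f \<in> Delta l {0..d}" "\<alpha> \<in> Sset d k r l f"
        using \<alpha> by (rule Sset_cover)
      moreover have "r l \<le> r 0" using lf(1) by (intro radius_antimono[OF rd dbl]) simp_all
      ultimately show ?thesis
        using simplex_of_eq[OF rd dbl k lf(2,3)] Sset_D(2)[OF lf(3)] by (auto simp: Delta_def)
    qed
    show ?thesis
    proof (rule invertible_on_triangular[where h = h])
      show "finite (lattice d k)" by (rule finite_lattice)
      show "Dmat v k r \<alpha> \<alpha> \<noteq> 0" if "\<alpha> \<in> lattice d k" for \<alpha>
        using loc[OF that] Dmat[of "?f \<alpha>" _ \<alpha> \<alpha>] that by auto
      fix \<alpha> \<beta> assume \<alpha>: "\<alpha> \<in> lattice d k" and \<beta>: "\<beta> \<in> lattice d k" and ne: "\<alpha> \<noteq> \<beta>"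
        and h: "h \<alpha> \<le> h \<beta>"
      obtain l where l: "?f \<alpha> \<in> Delta l {0..d}" "\<alpha> \<in> Sset d k r l (?f \<alpha>)"
          "card (?f \<alpha>) = l + 1" "ldist d \<alpha> (?f \<alpha>) \<le> r 0" using loc[OF \<alpha>] by blast
      obtain l' where l': "?f \<beta> \<in> Delta l' {0..d}" "\<beta> \<in> Sset d k r l' (?f \<beta>)"
          "card (?f \<beta>) = l' + 1" "ldist d \<beta> (?f \<beta>) \<le> r 0" using loc[OF \<beta>] by blast
      have "l \<le> l'"
      proof (rule ccontr)
        assume "\<not> l \<le> l'"
        then have "(l' + 2) * (r 0 + 1) \<le> (l + 1) * (r 0 + 1)" by (intro mult_right_mono) auto
        then show False using h l(3) l'(3,4) by (simp add: h_def)
      qed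
      moreover have "ldist d \<alpha> (?f \<alpha>) \<le> ldist d \<beta> (?f \<alpha>)" if "?f \<alpha> = ?f \<beta>"
        using h by (simp add: h_def that)
      ultimately show "Dmat v k r \<alpha> \<beta> = 0"
        using zero[OF l(1,2) l'(1,2)] ne by blast
    qed
  qed
  have "Dmat v k r \<alpha> \<beta> = fact k / fact (k - s) * (if \<alpha> = \<beta> then 1 else 0)"
    if "f \<in> Delta l {0..d}" "\<alpha> \<in> Sset d k r l f \<inter> Lset d k f s" "\<beta> \<in> Sset d k r l f \<inter> Lset d k f s"
    for l f s \<alpha> \<beta>
    using that Dmat[of f l \<alpha> \<beta>] by (auto simp: Lset_def)
  then show ?thesis using triangular invertible by blast
qed

end
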